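(* Let $\mathbf{k}$ be a finite field of characteristic $p$, let $m\ge1$, let $R$ be a field of characteristic different from $p$ (containing the $p$-th roots of unity), and let $\pi$ be an absolutely irreducible cuspidal $R$-representation of $G=\mathrm{GL}_{2m}(\mathbf{k})$ distinguished by $H$, where either $H=\mathrm{GL}_m(\mathbf{k})\times\mathrm{GL}_m(\mathbf{k})$, or $H=\mathrm{GL}_m(\boldsymbol{l})$ for $\boldsymbol{l}/\mathbf{k}$ a quadratic extension, embedded in $G$ as described in the context. Moreover, in the case $H=\mathrm{GL}_m(\mathbf{k})\times\mathrm{GL}_m(\mathbf{k})$, suppose that $p$ is odd. Let $\psi:\mathbf{k}\to R^\times$ be a non-trivial character, and choose $|M_{2m}(\mathbf{k})|^{1/2}=|\mathbf{k}|^{2m^2}$ in $R$. Then $$\gamma(\pi,\psi)=\chi_\pi(w),$$ where $w=\begin{pmatrix}0&1_m\\1_m&0\end{pmatrix}$ if $H=\mathrm{GL}_m(\mathbf{k})\times\mathrm{GL}_m(\mathbf{k})$, and $w=\mathrm{diag}(1_m,-1_m)$ if $H=\mathrm{GL}_m(\boldsymbol{l})$.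
   Context: Embeddings: $\mathrm{GL}_m(\mathbf{k})\times\mathrm{GL}_m(\mathbf{k})$ is embedded block diagonally in $G$. For $\boldsymbol{l}=\mathbf{k}[\sqrt\alpha]$ with $\alpha\in\mathbf{k}^\times$ not a square, $M_m(\boldsymbol{l})$ is embedded in $M_{2m}(\mathbf{k})$ as the set of matrices $\begin{pmatrix}x&y\\ \alpha y&x\end{pmatrix}$, $x,y\in M_m(\mathbf{k})$, and $\mathrm{GL}_m(\boldsymbol{l})$ is its unit group. An $R$-representation $(\pi,V)$ of $G$ is cuspidal if the coinvariants $V_U$ vanish for the unipotent radical $U$ of every proper parabolic subgroup of $G$; it is distinguished by $H$ if $\mathrm{Hom}_{R[H]}(\pi,R)\neq0$ (trivial action on $R$). In the situation of the claim this space is one-dimensional, so the normalizer $N$ of $H$ in $G$ acts on it through a character $\chi_\pi:N\to R^\times$ defined by $\Lambda\circ\pi(g)=\chi_\pi(g)\Lambda$ for $g\in N$, $\Lambda\in\mathrm{Hom}_{R[H]}(\pi,R)$. With $V^\vee=\mathrm{Hom}_R(V,R)$ and $\pi^\vee$ the contragredient, the gamma factor $\gamma(\pi,\psi)\in R$ is the scalar by which $|M_{2m}(\mathbf{k})|^{-1/2}\sum_{g\in G}\psi(\mathrm{tr}(g))\pi^\vee(g)$ acts on $V^\vee$. Equivalently, it is the scalar such that $\sum_{g\in G}\widehat\Phi(g)v^\vee(\pi(g^{-1})v)=\gamma(\pi,\psi)\sum_{g\in G}\Phi(g)v^\vee(\pi(g)v)$ for all $v\in V$, $v^\vee\in V^\vee$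 and all $\Phi:M_{2m}(\mathbf{k})\to R$ supported on $G$, with $\widehat\Phi(a)=|M_{2m}(\mathbf{k})|^{-1/2}\sum_{g\in M_{2m}(\mathbf{k})}\Phi(g)\psi(\mathrm{tr}(ga))$. *)

theory Defs
  imports
    "HOL-Analysis.Analysis"
    "HOL-Algebra.Algebraic_Closure_Type"
    "HOL-Library.Poly_Mapping"
begin

section \<open>The general linear group, parabolic subgroups and unipotent radicals\<close>

definition GL :: "('k::field^'n^'n) set" where
  "GL = {g. invertible g}"

definition unit_group :: "('k::field^'n^'n) set \<Rightarrow> ('k^'n^'n) set" where
  "unit_group E = {A \<in> E. \<exists>B\<in>E. A ** B = mat 1 \<and> B ** A = mat 1}"

definition normalizer_GL :: "('k::field^'n^'n) set \<Rightarrow> ('k^'n^'n) set" where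
  "normalizer_GL H = {g \<in> GL. (\<lambda>h. g ** h ** matrix_inv g) ` H = H}"

text \<open>A flag is a chain \<open>0 = W\<^sub>0 \<subset> W\<^sub>1 \<subset> \<dots> \<subset> W\<^sub>r = k\<^sup>n\<close> of subspaces. The parabolic subgroups
  of the general linear group over \<open>k\<close> are exactly the stabilizers of flags, and the unipotent
  radical of the stabilizer consists of the elements acting trivially on all the
  quotients \<open>W\<^sub>i\<^sub>+\<^sub>1 / W\<^sub>i\<close>.\<close>

definition is_flag :: "('k::field^'n) set list \<Rightarrow> bool" where
  "is_flag Ws \<longleftrightarrow> Ws \<noteq> [] \<and> hd Ws = {0} \<and> last Ws = UNIV \<and>
     (\<forall>W\<in>set Ws. vec.subspace W) \<and> sorted_wrt (\<subset>) Ws"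

definition parabolic :: "('k::field^'n) set list \<Rightarrow> ('k^'n^'n) set" where
  "parabolic Ws = {g \<in> GL. \<forall>W\<in>set Ws. (\<lambda>x. g *v x) ` W = W}"

definition unipotent_radical :: "('k::field^'n) set list \<Rightarrow> ('k^'n^'n) set" where
  "unipotent_radical Ws =
     {g \<in> parabolic Ws. \<forall>i. Suc i < length Ws \<longrightarrow> (\<forall>x \<in> Ws ! Suc i. g *v x - x \<in> Ws ! i)}"


section \<open>Representations on vector spaces\<close>

text \<open>The representation space is the whole type \<open>'v\<close> with scalar multiplication \<open>sc\<close>;
  only the values of \<open>\<pi>\<close> on \<^const>\<open>GL\<close> matter.\<close>

definition is_rep ::
  "('r::field \<Rightarrow> 'v::ab_group_add \<Rightarrow> 'v) \<Rightarrow> ('k::field^'n^'n \<Rightarrow> 'v \<Rightarrow> 'v) \<Rightarrow> bool" where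
  "is_rep sc \<pi> \<longleftrightarrow> vector_space sc \<and>
     (\<forall>g\<in>GL. Vector_Spaces.linear sc sc (\<pi> g)) \<and>
     \<pi> (mat 1) = id \<and>
     (\<forall>g\<in>GL. \<forall>h\<in>GL. \<pi> (g ** h) = \<pi> g \<circ> \<pi> h)"

definition irreducible_action ::
  "('r::field \<Rightarrow> 'v::ab_group_add \<Rightarrow> 'v) \<Rightarrow> 'v set \<Rightarrow> 'g set \<Rightarrow> ('g \<Rightarrow> 'v \<Rightarrow> 'v) \<Rightarrow> bool" where
  "irreducible_action sc V G \<pi> \<longleftrightarrow> V \<noteq> {0} \<and>
     (\<forall>W. module.subspace sc W \<and> W \<subseteq> V \<and> (\<forall>g\<in>G. \<forall>v\<in>W. \<pi> g v \<in> W) \<longrightarrow> W = {0} \<or> W = V)"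

text \<open>Extension of scalars of \<open>(\<pi>, V)\<close> from \<open>R\<close> to an algebraic closure \<open>L\<close>. After the choice
  of a basis \<open>B\<close> of \<open>V\<close>, the space \<open>L \<otimes> V\<close> is the space of finitely supported functions
  \<open>B \<rightarrow> L\<close>, where \<open>1 \<otimes> v\<close> is the coordinate vector of \<open>v\<close>, and \<open>g\<close> acts \<open>L\<close>-linearly,
  sending \<open>1 \<otimes> b\<close> to \<open>1 \<otimes> \<pi>(g) b\<close> for every \<open>b\<close> in \<open>B\<close>.\<close>

definition ext_basis :: "('r::field \<Rightarrow> 'v::ab_group_add \<Rightarrow> 'v) \<Rightarrow> 'v set" where
  "ext_basis sc = vector_space.extend_basis sc {}"

definition ext_scale :: "'l::field \<Rightarrow> ('v \<Rightarrow>\<^sub>0 'l) \<Rightarrow> ('v \<Rightarrow>\<^sub>0 'l)" where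
  "ext_scale c f = Poly_Mapping.map ((*) c) f"

definition ext_space ::
  "('r::field \<Rightarrow> 'v::ab_group_add \<Rightarrow> 'v) \<Rightarrow> ('v \<Rightarrow>\<^sub>0 'r alg_closure) set" where
  "ext_space sc = {f. Poly_Mapping.keys f \<subseteq> ext_basis sc}"

definition ext_vec ::
  "('r::field \<Rightarrow> 'v::ab_group_add \<Rightarrow> 'v) \<Rightarrow> 'v \<Rightarrow> ('v \<Rightarrow>\<^sub>0 'r alg_closure)" where
  "ext_vec sc v = (let x = module.representation sc (ext_basis sc) v in
     \<Sum>b | x b \<noteq> 0. Poly_Mapping.single b (to_ac (x b)))"

definition ext_action ::
  "('r::field \<Rightarrow> 'v::ab_group_add \<Rightarrow> 'v) \<Rightarrow> ('g \<Rightarrow> 'v \<Rightarrow> 'v) \<Rightarrow>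
     'g \<Rightarrow> ('v \<Rightarrow>\<^sub>0 'r alg_closure) \<Rightarrow> ('v \<Rightarrow>\<^sub>0 'r alg_closure)" where
  "ext_action sc \<pi> g f =
     (\<Sum>b\<in>Poly_Mapping.keys f. ext_scale (Poly_Mapping.lookup f b) (ext_vec sc (\<pi> g b)))"

definition absolutely_irreducible ::
  "('r::field \<Rightarrow> 'v::ab_group_add \<Rightarrow> 'v) \<Rightarrow> ('k::field^'n^'n \<Rightarrow> 'v \<Rightarrow> 'v) \<Rightarrow> bool" where
  "absolutely_irreducible sc \<pi> \<longleftrightarrow>
     irreducible_action ext_scale (ext_space sc) GL (ext_action sc \<pi>)"

text \<open>The space of coinvariants \<open>V\<^sub>U\<close> is the quotient of \<open>V\<close> by \<open>coinvariant_kernel sc \<pi> U\<close>, so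
  it vanishes iff this kernel is all of \<open>V\<close>.\<close>

definition coinvariant_kernel ::
  "('r::field \<Rightarrow> 'v::ab_group_add \<Rightarrow> 'v) \<Rightarrow> ('g \<Rightarrow> 'v \<Rightarrow> 'v) \<Rightarrow> 'g set \<Rightarrow> 'v set" where
  "coinvariant_kernel sc \<pi> U = module.span sc {\<pi> u v - v | u v. u \<in> U}"

definition cuspidal ::
  "('r::field \<Rightarrow> 'v::ab_group_add \<Rightarrow> 'v) \<Rightarrow> ('k::field^'n^'n \<Rightarrow> 'v \<Rightarrow> 'v) \<Rightarrow> bool" where
  "cuspidal sc \<pi> \<longleftrightarrow>
     (\<forall>Ws. is_flag Ws \<and> parabolic Ws \<noteq> GL \<longrightarrow>
        coinvariant_kernel sc \<pi> (unipotent_radical Ws) = UNIV)"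

definition dual_space :: "('r::field \<Rightarrow> 'v::ab_group_add \<Rightarrow> 'v) \<Rightarrow> ('v \<Rightarrow> 'r) set" where
  "dual_space sc = {\<Lambda>. Vector_Spaces.linear sc (*) \<Lambda>}"

definition contragredient ::
  "('k::field^'n^'n \<Rightarrow> 'v \<Rightarrow> 'v) \<Rightarrow> 'k^'n^'n \<Rightarrow> ('v \<Rightarrow> 'r) \<Rightarrow> ('v \<Rightarrow> 'r)" where
  "contragredient \<pi> g \<Lambda> = (\<lambda>v. \<Lambda> (\<pi> (matrix_inv g) v))"

definition Hom_triv ::
  "('r::field \<Rightarrow> 'v::ab_group_add \<Rightarrow> 'v) \<Rightarrow> ('g \<Rightarrow> 'v \<Rightarrow> 'v) \<Rightarrow> 'g set \<Rightarrow> ('v \<Rightarrow> 'r) set" where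
  "Hom_triv sc \<pi> H = {\<Lambda> \<in> dual_space sc. \<forall>h\<in>H. \<forall>v. \<Lambda> (\<pi> h v) = \<Lambda> v}"

definition distinguished ::
  "('r::field \<Rightarrow> 'v::ab_group_add \<Rightarrow> 'v) \<Rightarrow> ('g \<Rightarrow> 'v \<Rightarrow> 'v) \<Rightarrow> 'g set \<Rightarrow> bool" where
  "distinguished sc \<pi> H \<longleftrightarrow> (\<exists>\<Lambda>\<in>Hom_triv sc \<pi> H. \<Lambda> \<noteq> (\<lambda>_. 0))"

text \<open>The function \<open>\<chi>\<^sub>\<pi>\<close> on the normalizer of \<open>H\<close>; its value is meaningful only where the
  normalizer acts on a nonzero \<open>Hom_triv sc \<pi> H\<close> by scalars.\<close>

definition chi ::
  "('r::field \<Rightarrow> 'v::ab_group_add \<Rightarrow> 'v) \<Rightarrow> ('k::field^'n^'n \<Rightarrow> 'v \<Rightarrow> 'v) \<Rightarrow>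
     ('k^'n^'n) set \<Rightarrow> 'k^'n^'n \<Rightarrow> 'r" where
  "chi sc \<pi> H = restrict
     (\<lambda>g. THE c. \<forall>\<Lambda>\<in>Hom_triv sc \<pi> H. \<forall>v. \<Lambda> (\<pi> g v) = c * \<Lambda> v) (normalizer_GL H)"


section \<open>Additive characters and the gamma factor\<close>

definition nontrivial_additive_character :: "('k::field \<Rightarrow> 'r::field) \<Rightarrow> bool" where
  "nontrivial_additive_character \<psi> \<longleftrightarrow>
     (\<forall>x. \<psi> x \<noteq> 0) \<and> (\<forall>x y. \<psi> (x + y) = \<psi> x * \<psi> y) \<and> (\<exists>x. \<psi> x \<noteq> 1)"

text \<open>The parameter \<open>s\<close> is the chosen square root in \<open>R\<close> of the number of \<open>n \<times> n\<close>-matrices.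
  The scalar exists, by Schur's lemma, when \<open>\<pi>\<close> is absolutely irreducible.\<close>

definition gamma_factor ::
  "('r::field \<Rightarrow> 'v::ab_group_add \<Rightarrow> 'v) \<Rightarrow> ('k::{field,finite}^'n^'n \<Rightarrow> 'v \<Rightarrow> 'v) \<Rightarrow>
     ('k \<Rightarrow> 'r) \<Rightarrow> 'r \<Rightarrow> 'r" where
  "gamma_factor sc \<pi> \<psi> s = (THE c. \<forall>\<Lambda>\<in>dual_space sc. \<forall>v.
     inverse s * (\<Sum>g\<in>GL. \<psi> (trace g) * contragredient \<pi> g \<Lambda> v) = c * \<Lambda> v)"


section \<open>Block matrices and the two subgroups\<close>

text \<open>Matrices of size \<open>2m\<close> are indexed by the sum type \<open>'m + 'm\<close> with \<open>m = CARD('m)\<close>.\<close>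

definition block_mat ::
  "'k^'m^'m \<Rightarrow> 'k^'m^'m \<Rightarrow> 'k^'m^'m \<Rightarrow> 'k^'m^'m \<Rightarrow> 'k^('m + 'm)^('m + 'm)" where
  "block_mat x y z t = (\<chi> i j.
     case i of
       Inl a \<Rightarrow> (case j of Inl b \<Rightarrow> x $ a $ b | Inr b \<Rightarrow> y $ a $ b)
     | Inr a \<Rightarrow> (case j of Inl b \<Rightarrow> z $ a $ b | Inr b \<Rightarrow> t $ a $ b))"

definition GL_prod :: "('k::field^('m::finite + 'm)^('m + 'm)) set" where
  "GL_prod = {block_mat x 0 0 y | x y. x \<in> GL \<and> y \<in> GL}"

definition mat_quadratic :: "'k::field \<Rightarrow> ('k^('m::finite + 'm)^('m + 'm)) set" where
  "mat_quadratic \<alpha> = {block_mat x y (\<chi> i j. \<alpha> * y $ i $ j) x | x y. True}"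

definition GL_quadratic :: "'k::field \<Rightarrow> ('k^('m::finite + 'm)^('m + 'm)) set" where
  "GL_quadratic \<alpha> = unit_group (mat_quadratic \<alpha>)"

end

theory Submission
  imports Defs "HOL-Algebra.Sylow"
begin

text \<open>In both cases \<open>H\<close> is the unit group of the centralizer \<open>A\<close> of a matrix \<open>J\<close> whose square is a
  nonzero scalar, and \<open>w\<close> is an involution with \<open>w J = - J w\<close>; the orthogonal of \<open>A\<close> for the trace
  form is \<open>w A\<close>. Let \<open>T\<close> be the sum of the \<open>\<psi>(tr g) \<pi>(g\<^sup>-\<^sup>1)\<close> over \<open>G\<close> and \<open>\<Lambda>\<close> an \<open>H\<close>-invariant
  functional. Grouping by cosets \<open>g H\<close>, the functional \<open>\<Lambda> T\<close> becomes a sum over \<open>G/H\<close> of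
  \<open>\<Lambda> \<pi>(g\<^sup>-\<^sup>1)\<close> weighted by the sum of \<open>\<psi>(tr (g h))\<close> over \<open>h \<in> H\<close>. This inner sum may be extended to
  all of \<open>A\<close>: the elements \<open>a \<in> A\<close> with a given nonzero kernel \<open>W\<close> contribute a functional invariant
  under all \<open>u\<close> with image of \<open>u - 1\<close> in \<open>W\<close>, hence zero by cuspidality. The complete sum is \<open>|A|\<close>
  on \<open>w H\<close> and \<open>0\<close> elsewhere, so \<open>\<Lambda> T = |A| \<Lambda> \<pi>(w)\<close>. As this holds for every \<open>\<Lambda>\<close>, multiplicity
  one is not needed. Schur's lemma is not needed either: \<open>T\<close> commutes with \<open>G\<close> and \<open>\<Lambda> T\<^sup>2 = |A|\<^sup>2 \<Lambda>\<close>,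
  so irreducibility forces \<open>T\<^sup>2 = |A|\<^sup>2\<close>, and then \<open>T = \<plusminus>|A|\<close>.\<close>

no_notation fps_nth (infixl \<open>$\<close> 75)

section \<open>Inverses in the general linear group\<close>

lemma GL_mult: "g \<in> GL \<Longrightarrow> h \<in> GL \<Longrightarrow> g ** h \<in> GL"
  by (simp add: GL_def invertible_mult)

lemma mat_1_GL: "mat 1 \<in> GL"
  unfolding GL_def invertible_def by (auto intro!: exI[of _ "mat 1"])

lemma GL_matrix_inv:
  assumes "g \<in> GL"
  shows "g ** matrix_inv g = mat 1" "matrix_inv g ** g = mat 1"
proof -
  have "g ** matrix_inv g = mat 1 \<and> matrix_inv g ** g = mat 1"
    using assms unfolding GL_def invertible_def matrix_inv_def mem_Collect_eq by (rule someI_ex)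
  then show "g ** matrix_inv g = mat 1" "matrix_inv g ** g = mat 1" by auto
qed

lemma matrix_inv_GL: "g \<in> GL \<Longrightarrow> matrix_inv g \<in> GL"
  using GL_matrix_inv[of g] by (auto simp: GL_def invertible_def)

lemma matrix_inv_unique_GL:
  fixes g h :: "'k::field^'n^'n"
  assumes "g ** h = mat 1"
  shows "g \<in> GL" "matrix_inv g = h"
proof -
  have "h ** g = mat 1" using assms by (simp add: matrix_left_right_inverse)
  then show g: "g \<in> GL" using assms by (auto simp: GL_def invertible_def)
  have "matrix_inv g = matrix_inv g ** (g ** h)" by (simp add: assms)
  also have "\<dots> = h" by (simp only: matrix_mul_assoc GL_matrix_inv[OF g] matrix_mul_lid)
  finally show "matrix_inv g = h" .
qed

lemma GL_cancel_left:
  assumes "g \<in> GL"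
  shows "matrix_inv g ** (g ** x) = x" "g ** (matrix_inv g ** x) = x"
  by (simp_all only: matrix_mul_assoc GL_matrix_inv[OF assms] matrix_mul_lid)

lemma GL_cancel_right:
  assumes "g \<in> GL"
  shows "x ** g ** matrix_inv g = x" "x ** matrix_inv g ** g = x"
  by (simp_all only: matrix_mul_assoc[symmetric] GL_matrix_inv[OF assms] matrix_mul_rid)

lemma matrix_inv_mult_GL:
  fixes g h :: "'k::field^'n^'n"
  assumes "g \<in> GL" "h \<in> GL"
  shows "matrix_inv (g ** h) = matrix_inv h ** matrix_inv g"
  by (rule matrix_inv_unique_GL)
    (simp add: matrix_mul_assoc GL_cancel_right GL_matrix_inv assms)

lemma matrix_inv_inv_GL:
  fixes g :: "'k::field^'n^'n"
  assumes "g \<in> GL"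
  shows "matrix_inv (matrix_inv g) = g"
  by (rule matrix_inv_unique_GL) (simp add: GL_matrix_inv assms)

lemma GL_iff_ker:
  fixes g :: "'k::field^'n^'n"
  shows "g \<in> GL \<longleftrightarrow> {x. g *v x = 0} = {0}"
  unfolding GL_def mem_Collect_eq invertible_left_inverse matrix_left_invertible_ker by auto

section \<open>Sums over cosets\<close>

definition matrix_subgroup :: "('k::field^'n^'n) set \<Rightarrow> bool" where
  "matrix_subgroup H \<longleftrightarrow> H \<subseteq> GL \<and> mat 1 \<in> H \<and> (\<forall>g\<in>H. \<forall>h\<in>H. g ** h \<in> H) \<and>
     (\<forall>h\<in>H. matrix_inv h \<in> H)"

definition left_coset :: "('k::field^'n^'n) set \<Rightarrow> 'k^'n^'n \<Rightarrow> ('k^'n^'n) set" where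
  "left_coset H g = (\<lambda>h. g ** h) ` H"

definition coset_rep :: "('k::field^'n^'n) set \<Rightarrow> ('k^'n^'n) set \<Rightarrow> 'k^'n^'n" where
  "coset_rep H c = (SOME g. g \<in> GL \<and> left_coset H g = c)"

text \<open>The order of \<open>H\<close> may vanish in \<open>'r\<close>, so sums over \<open>G/H\<close> cannot be obtained by averaging. The
  value does not depend on the representatives only when \<open>F\<close> is right invariant.\<close>

definition coset_sum ::
  "('k::{field,finite}^'n^'n) set \<Rightarrow> ('k^'n^'n \<Rightarrow> 'r::comm_ring_1) \<Rightarrow> 'r" where
  "coset_sum H F = (\<Sum>c\<in>left_coset H ` GL. F (coset_rep H c))"

definition right_invariant :: "('k::field^'n^'n) set \<Rightarrow> ('k^'n^'n \<Rightarrow> 'r) \<Rightarrow> bool" where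
  "right_invariant H F \<longleftrightarrow> (\<forall>g\<in>GL. \<forall>h\<in>H. F (g ** h) = F g)"

lemma coset_rep:
  assumes "c \<in> left_coset H ` GL"
  shows "coset_rep H c \<in> GL" "left_coset H (coset_rep H c) = c"
proof -
  have "\<exists>g. g \<in> GL \<and> left_coset H g = c" using assms by auto
  then have "coset_rep H c \<in> GL \<and> left_coset H (coset_rep H c) = c"
    unfolding coset_rep_def by (rule someI_ex)
  then show "coset_rep H c \<in> GL" "left_coset H (coset_rep H c) = c" by auto
qed

lemma left_coset_eq_iff:
  assumes H: "matrix_subgroup H" and "g \<in> GL"
  shows "left_coset H g' = left_coset H g \<longleftrightarrow> g' \<in> left_coset H g"
proof
  assume "left_coset H g' = left_coset H g"
  moreover have "g' \<in> left_coset H g'"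
    using H unfolding left_coset_def matrix_subgroup_def by (auto intro!: image_eqI[of _ _ "mat 1"])
  ultimately show "g' \<in> left_coset H g" by simp
next
  assume "g' \<in> left_coset H g"
  then obtain h where h: "h \<in> H" "g' = g ** h" by (auto simp: left_coset_def)
  then have hG: "h \<in> GL" using H by (auto simp: matrix_subgroup_def)
  show "left_coset H g' = left_coset H g"
  proof
    show "left_coset H g' \<subseteq> left_coset H g"
      using h H by (auto simp: left_coset_def matrix_subgroup_def matrix_mul_assoc[symmetric])
    show "left_coset H g \<subseteq> left_coset H g'"
    proof
      fix x assume "x \<in> left_coset H g"
      then obtain k where k: "k \<in> H" "x = g ** k" by (auto simp: left_coset_def)
      then have "x = g' ** (matrix_inv h ** k)"
        using h by (simp add: matrix_mul_assoc GL_cancel_right[OF hG])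
      then show "x \<in> left_coset H g'"
        using H h k by (auto simp: left_coset_def matrix_subgroup_def)
    qed
  qed
qed

lemma right_invariant_left_coset:
  assumes "right_invariant H F" "matrix_subgroup H" "g \<in> GL" "left_coset H g' = left_coset H g"
  shows "F g' = F g"
proof -
  have "g' \<in> left_coset H g" using assms left_coset_eq_iff by blast
  then show ?thesis using assms by (auto simp: right_invariant_def left_coset_def)
qed

text \<open>The fibres of \<open>left_coset H\<close> partition GL, and each is the injective image
  of \<open>H\<close> under left multiplication by its chosen representative. The inner sum runs
  through the whole coset whatever representative was chosen.\<close>

lemma sum_GL_eq_coset_sum:
  fixes f :: "'k::{field,finite}^'n^'n \<Rightarrow> 'r::comm_ring_1"
  assumes H: "matrix_subgroup H"
  shows "(\<Sum>g\<in>GL. f g) = coset_sum H (\<lambda>g. \<Sum>h\<in>H. f (g ** h))"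
proof -
  have "(\<Sum>g\<in>GL. f g) = (\<Sum>c\<in>left_coset H ` GL. \<Sum>g\<in>{g\<in>GL. left_coset H g = c}. f g)"
    by (rule sum.group[symmetric]) auto
  also have "\<dots> = (\<Sum>c\<in>left_coset H ` GL. \<Sum>h\<in>H. f (coset_rep H c ** h))"
  proof (rule sum.cong[OF refl])
    fix c assume c: "c \<in> left_coset H ` GL"
    note r = coset_rep[OF c]
    have "{g\<in>GL. left_coset H g = c} = left_coset H (coset_rep H c)"
      using left_coset_eq_iff[OF H r(1)] r(2) H r(1)
      by (auto simp: left_coset_def matrix_subgroup_def intro!: GL_mult)
    moreover have "inj_on (\<lambda>h. coset_rep H c ** h) H"
      by (metis GL_cancel_left(1) inj_onI r(1))
    ultimately show "(\<Sum>g\<in>{g\<in>GL. left_coset H g = c}. f g) = (\<Sum>h\<in>H. f (coset_rep H c ** h))"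
      by (simp add: left_coset_def sum.reindex)
  qed
  finally show ?thesis by (simp add: coset_sum_def)
qed

lemma left_coset_translate: "left_coset H (u ** g) = (\<lambda>x. u ** x) ` left_coset H g"
  by (auto simp: left_coset_def image_image matrix_mul_assoc)

text \<open>Change of variables on G/H. Left multiplication by \<open>u\<close> permutes the cosets;
  the representative chosen for the translate of \<open>c\<close> and \<open>u\<close> times the one
  chosen for \<open>c\<close> differ by a right factor in \<open>H\<close>, which the invariance of
  \<open>F\<close> absorbs.\<close>

lemma coset_sum_translate:
  fixes F :: "'k::{field,finite}^'n^'n \<Rightarrow> 'r::comm_ring_1"
  assumes H: "matrix_subgroup H" and F: "right_invariant H F" and u: "u \<in> GL"
  shows "coset_sum H (\<lambda>g. F (u ** g)) = coset_sum H F"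
  unfolding coset_sum_def
proof (rule sum.reindex_bij_witness[of _ "\<lambda>c. (\<lambda>x. matrix_inv u ** x) ` c" "\<lambda>c. (\<lambda>x. u ** x) ` c"])
  let ?u = "matrix_inv u"
  fix c assume c: "c \<in> left_coset H ` GL"
  note r = coset_rep[OF c]
  show "(\<lambda>x. u ** x) ` (\<lambda>x. ?u ** x) ` c = c" "(\<lambda>x. ?u ** x) ` (\<lambda>x. u ** x) ` c = c"
    by (simp_all add: image_image GL_cancel_left[OF u])
  have 1: "(\<lambda>x. v ** x) ` c = left_coset H (v ** coset_rep H c)" for v
    by (simp add: left_coset_translate r)
  show uc: "(\<lambda>x. u ** x) ` c \<in> left_coset H ` GL" "(\<lambda>x. ?u ** x) ` c \<in> left_coset H ` GL"
    using u r(1) matrix_inv_GL[OF u] unfolding 1 by (auto intro!: imageI GL_mult)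
  show "F (coset_rep H ((\<lambda>x. u ** x) ` c)) = F (u ** coset_rep H c)"
    by (rule right_invariant_left_coset[OF F H])
      (use coset_rep[OF uc(1)] u r in \<open>auto simp: left_coset_translate intro: GL_mult\<close>)
qed

text \<open>The coset of \<open>w\<close> occurs exactly once among the indices, and right
  invariance lets \<open>F\<close> be read at \<open>w\<close> instead of at the chosen
  representative.\<close>

lemma coset_sum_indicator:
  fixes F :: "'k::{field,finite}^'n^'n \<Rightarrow> 'r::comm_ring_1"
  assumes H: "matrix_subgroup H" and F: "right_invariant H F" and w: "w \<in> GL"
  shows "coset_sum H (\<lambda>g. if g \<in> left_coset H w then F g else 0) = F w"
proof -
  have "coset_sum H (\<lambda>g. if g \<in> left_coset H w then F g else 0) =
      (\<Sum>c\<in>left_coset H ` GL. if c = left_coset H w then F w else 0)"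
    unfolding coset_sum_def
  proof (rule sum.cong[OF refl])
    fix c assume c: "c \<in> left_coset H ` GL"
    note r = coset_rep[OF c]
    show "(if coset_rep H c \<in> left_coset H w then F (coset_rep H c) else 0) =
        (if c = left_coset H w then F w else 0)"
      using left_coset_eq_iff[OF H w, of "coset_rep H c"] r
        right_invariant_left_coset[OF F H w, of "coset_rep H c"] by auto
  qed
  also have "\<dots> = F w" using w by (simp add: sum.delta)
  finally show ?thesis .
qed

lemma coset_sum_cong:
  "(\<And>g. g \<in> GL \<Longrightarrow> F g = F' g) \<Longrightarrow> coset_sum H F = coset_sum H F'"
  unfolding coset_sum_def by (rule sum.cong) (use coset_rep(1) in blast)+

section \<open>Unipotent radicals\<close>

text \<open>This turns a kernel \<open>W\<close> into a unipotent radical to which cuspidality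
  applies. For a flag 0 < W' < k^n with W' inside \<open>W\<close>, an element of the radical acts
  trivially on k^n / W', so \<open>u - 1\<close> maps into W'. The parabolic is proper because some
  transvection moves W'.\<close>

lemma exists_unipotent_radical:
  fixes W :: "('k::field^'n) set"
  assumes W: "vec.subspace W" "W \<noteq> {0}" and n: "CARD('n) \<ge> 2"
  shows "\<exists>Ws. is_flag Ws \<and> parabolic Ws \<noteq> GL \<and>
    (\<forall>u\<in>unipotent_radical Ws. \<forall>x. u *v x - x \<in> W)"
proof -
  have "\<exists>W'. vec.subspace W' \<and> W' \<noteq> {0} \<and> W' \<noteq> UNIV \<and> W' \<subseteq> W"
  proof (cases "W = UNIV")
    case True
    \<comment> \<open>The whole space is replaced by the hyperplane x_i = 0: it is proper, and it is
      nonzero because it contains the basis vector e_j, whose index exists as n >= 2.\<close>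
    obtain i j :: 'n where ij: "i \<noteq> j"
      using n card_le_Suc0_iff_eq[of "UNIV :: 'n set"] by auto
    let ?W = "{x::'k^'n. x $ i = 0}"
    have "axis j 1 \<in> ?W" "axis i 1 \<notin> ?W" "axis j (1::'k) \<noteq> 0" using ij by (auto simp: axis_def vec_eq_iff)
    moreover have "vec.subspace ?W" by (auto simp: vec.subspace_def)
    ultimately show ?thesis using True by (metis UNIV_I singletonD top_greatest)
  next
    case False
    then show ?thesis using W by auto
  qed
  then obtain W' where W': "vec.subspace W'" "W' \<noteq> {0}" "W' \<noteq> UNIV" "W' \<subseteq> W" by auto
  have 0: "0 \<in> W'" using W' by (simp add: vec.subspace_0)
  obtain x where x: "x \<in> W'" "x \<noteq> 0" using W' 0 by auto
  obtain j where j: "axis j (1::'k) \<notin> W'"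
  proof (rule ccontr)
    assume "\<not> thesis"
    then have "cart_basis \<subseteq> W'" using that by (auto simp: cart_basis_def)
    then have "vec.span cart_basis \<subseteq> W'" using W'(1) by (rule vec.span_minimal)
    then show False using W'(3) by (auto simp: span_cart_basis)
  qed
  \<comment> \<open>If \<open>x\<close> had no nonzero coordinate besides the j-th, it would be a
    nonzero multiple of e_j, which would then lie in W'.\<close>
  obtain i where i: "i \<noteq> j" "x $ i \<noteq> 0"
  proof (rule ccontr)
    assume "\<not> thesis"
    then have z: "x $ i = 0" if "i \<noteq> j" for i using that \<open>\<And>i. i \<noteq> j \<Longrightarrow> x $ i \<noteq> 0 \<Longrightarrow> thesis\<close> by blast
    then have "x $ j \<noteq> 0" using x(2) by (metis vec_eq_iff zero_index)
    moreover have "axis j 1 = inverse (x $ j) *s x"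
      using z \<open>x $ j \<noteq> 0\<close> by (auto simp: vec_eq_iff axis_def)
    ultimately show False using j x W' by (simp add: vec.subspace_scale)
  qed
  \<comment> \<open>\<open>E c\<close> is the transvection y -> y + c y_i e_j, invertible since i
    and j differ. It sends \<open>x\<close> to x + x_i e_j, which is outside W' because e_j
    is.\<close>
  define E :: "'k \<Rightarrow> 'k^'n^'n" where
    "E c = (\<chi> a b. (if a = b then 1 else 0) + (if a = j \<and> b = i then c else 0))" for c
  have Ev: "E c *v y = y + (c * y $ i) *s axis j 1" for c y
    by (auto simp: E_def vec_eq_iff matrix_vector_mult_def axis_def distrib_right sum.distrib
        if_distrib[of "\<lambda>x. x * _"] sum.delta cong: if_cong)

  have "E 1 ** E (-1) = mat 1"
    unfolding matrix_eq matrix_vector_mul_assoc[symmetric] Ev using i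
    by (auto simp: vec_eq_iff axis_def)
  then have g: "E 1 \<in> GL" by (rule matrix_inv_unique_GL)
  have "E 1 *v x \<notin> W'"
  proof
    assume "E 1 *v x \<in> W'"
    then have "E 1 *v x - x \<in> W'" using x W' by (simp add: vec.subspace_diff)
    then have "inverse (x $ i) *s (E 1 *v x - x) \<in> W'" by (rule vec.subspace_scale[OF W'(1)])
    moreover have "inverse (x $ i) *s (E 1 *v x - x) = axis j 1"
      using i by (auto simp: Ev vec_eq_iff)
    ultimately show False using j by simp
  qed
  then have gp: "E 1 \<notin> parabolic [{0}, W', UNIV]" using x by (auto simp: parabolic_def)
  have "is_flag [{0}, W', UNIV]" using W' 0 by (auto simp: is_flag_def)
  moreover have "u *v y - y \<in> W" if "u \<in> unipotent_radical [{0}, W', UNIV]" for u y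
  proof -
    have *: "\<forall>i. Suc i < length [{0}, W', UNIV] \<longrightarrow>
        (\<forall>x\<in>[{0}, W', UNIV] ! Suc i. u *v x - x \<in> [{0}, W', UNIV] ! i)"
      using that by (auto simp: unipotent_radical_def)
    \<comment> \<open>Index 1 selects the top quotient UNIV / W' of the flag.\<close>
    show ?thesis using spec[OF *, of 1] W' by auto
  qed
  ultimately show ?thesis using g gp by blast
qed

section \<open>Centralizers and the trace form\<close>

definition centralizer :: "'k::field^'n^'n \<Rightarrow> ('k^'n^'n) set" where
  "centralizer J = {a. a ** J = J ** a}"

lemma mat_commute: "mat c ** x = x ** (mat c :: 'k::field^'n^'n)"
  by (simp add: vec_eq_iff matrix_matrix_mult_def mat_def if_distrib[of "\<lambda>x. x * _"]
      if_distrib[of "\<lambda>x. _ * x"] mult.commute cong: if_cong)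

lemma mat_mult_mat: "mat c ** mat d = (mat (c * d) :: 'k::field^'n^'n)"
  by (auto simp: vec_eq_iff matrix_matrix_mult_def mat_def if_distrib[of "\<lambda>x. x * _"]
      if_distrib[of "\<lambda>x. _ * x"] mult.commute cong: if_cong)

lemma trace_mat_mult: "trace (mat c ** x) = c * trace (x :: 'k::field^'n^'n)"
  by (simp add: trace_def matrix_matrix_mult_def mat_def if_distrib[of "\<lambda>x. x * _"] sum_distrib_left
      cong: if_cong)

lemma matrix_mult_minus_left: "(- x) ** y = - (x ** (y :: 'k::field^'n^'n))"
  by (simp add: vec_eq_iff matrix_matrix_mult_def sum_negf)

lemma matrix_mult_minus_right: "x ** (- y) = - (x ** (y :: 'k::field^'n^'n))"
  by (simp add: vec_eq_iff matrix_matrix_mult_def sum_negf)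

lemma matrix_add_rdistrib: "(x + y) ** z = x ** z + y ** (z :: 'k::field^'n^'n)"
  by (simp add: vec_eq_iff matrix_matrix_mult_def distrib_right sum.distrib)

lemma matrix_diff_rdistrib: "(x - y) ** z = x ** z - y ** (z :: 'k::field^'n^'n)"
  by (simp add: vec_eq_iff matrix_matrix_mult_def left_diff_distrib sum_subtractf)

lemma matrix_diff_ldistrib: "z ** (x - y) = z ** x - z ** (y :: 'k::field^'n^'n)"
  by (simp add: vec_eq_iff matrix_matrix_mult_def right_diff_distrib sum_subtractf)

lemma trace_minus: "trace (- x) = - trace (x :: 'k::field^'n^'n)"
  by (simp add: trace_def sum_negf)

lemma matrix_eq_minus_self:
  fixes d :: "'k::field^'n^'n"
  assumes "(2::'k) \<noteq> 0" "d = - d" shows "d = 0"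
proof -
  have "d $ i $ j = 0" for i j
  proof -
    have "d $ i $ j = - (d $ i $ j)" using assms(2) by (metis vector_uminus_component)
    then have "2 * d $ i $ j = 0" by (simp only: eq_neg_iff_add_eq_0 mult_2)
    then show ?thesis using assms(1) by simp
  qed
  then show ?thesis by (simp add: vec_eq_iff)
qed

text \<open>Nondegeneracy of the trace form: pairing with the elementary matrix whose only entry is
  at (j, i) reads off the entry (i, j).\<close>

lemma matrix_eq_if_trace_eq:
  fixes x y :: "'k::field^'n^'n"
  assumes "\<And>z. trace (x ** z) = trace (y ** z)"
  shows "x = y"
proof -
  have *: "trace (x ** (\<chi> a b. if a = j \<and> b = i then 1 else 0)) = x $ i $ j" for x :: "'k^'n^'n" and i j
  proof -
    have "x ** (\<chi> a b. if a = j \<and> b = i then 1 else 0) = (\<chi> a b. if b = i then x $ a $ j else 0)"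
      by (auto simp: vec_eq_iff matrix_matrix_mult_def if_distrib[of "\<lambda>x. _ * x"] cong: if_cong)
    then show ?thesis by (simp add: trace_def)
  qed
  show ?thesis unfolding vec_eq_iff using assms * by metis
qed

lemma centralizer_mult: "a \<in> centralizer J \<Longrightarrow> b \<in> centralizer J \<Longrightarrow> a ** b \<in> centralizer J"
  unfolding centralizer_def mem_Collect_eq by (metis matrix_mul_assoc)

lemma centralizer_add: "a \<in> centralizer J \<Longrightarrow> b \<in> centralizer J \<Longrightarrow> a + b \<in> centralizer J"
  unfolding centralizer_def mem_Collect_eq by (simp add: matrix_add_ldistrib matrix_add_rdistrib)

lemma centralizer_mat: "mat c \<in> centralizer J"
  by (simp add: centralizer_def mat_commute)

lemma centralizer_matrix_inv:
  assumes "a \<in> centralizer J" "a \<in> GL"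
  shows "matrix_inv a \<in> centralizer J"
proof -
  have "matrix_inv a ** J = matrix_inv a ** (J ** a) ** matrix_inv a"
    by (simp add: matrix_mul_assoc GL_cancel_right assms)
  also have "\<dots> = matrix_inv a ** (a ** J) ** matrix_inv a" using assms by (simp add: centralizer_def)
  also have "\<dots> = J ** matrix_inv a" by (simp add: GL_cancel_left assms)
  finally show ?thesis by (simp add: centralizer_def)
qed

lemma matrix_subgroup_centralizer: "matrix_subgroup (centralizer J \<inter> GL)"
  unfolding matrix_subgroup_def
  using centralizer_mult[of _ J] centralizer_matrix_inv[of _ J] centralizer_mat[of 1 J] mat_1_GL GL_mult matrix_inv_GL
  by blast

text \<open>Common setting of the two cases. The product subgroup comes from J = diag(1, -1) with
  \<beta> = 1, the quadratic one from the matrix J of multiplication by the square root of \<alpha>,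
  with \<beta> = \<alpha>.\<close>

locale anticommuting_pair =
  fixes J w :: "'k::{field,finite}^'n^'n" and \<beta> :: 'k
  assumes two: "(2::'k) \<noteq> 0"
    and J_square: "J ** J = mat \<beta>" and \<beta>: "\<beta> \<noteq> 0"
    and w_square: "w ** w = mat 1"
    and anticommute: "w ** J = - (J ** w)"
begin

text \<open>Since the inverse of \<open>J\<close> is \<beta>^-1 J, this is conjugation by
  \<open>J\<close>. It is an involution with the centralizer of \<open>J\<close> as its
  +1-eigenspace and the matrices anticommuting with \<open>J\<close> as its -1-eigenspace.\<close>

definition conjJ :: "'k^'n^'n \<Rightarrow> 'k^'n^'n" where
  "conjJ x = mat (inverse \<beta>) ** (J ** x ** J)"

lemma conjJ_J: "conjJ x ** J = J ** x" "J ** conjJ x = x ** J"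
proof -
  have "conjJ x ** J = mat (inverse \<beta>) ** (J ** x ** (J ** J))"
    by (simp add: conjJ_def matrix_mul_assoc)
  also have "\<dots> = mat (inverse \<beta>) ** (mat \<beta> ** (J ** x))" by (simp add: J_square mat_commute)
  also have "\<dots> = J ** x" using \<beta> by (simp add: matrix_mul_assoc mat_mult_mat)
  finally show "conjJ x ** J = J ** x" .
  have "J ** conjJ x = (J ** mat (inverse \<beta>)) ** (J ** x ** J)"
    by (simp add: conjJ_def matrix_mul_assoc)
  also have "\<dots> = mat (inverse \<beta>) ** ((J ** J) ** (x ** J))"
    by (simp add: mat_commute[symmetric] matrix_mul_assoc)
  also have "\<dots> = x ** J" using \<beta> by (simp add: matrix_mul_assoc mat_mult_mat J_square)
  finally show "J ** conjJ x = x ** J" .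
qed

lemma add_conjJ_centralizer: "x + conjJ x \<in> centralizer J"
  by (simp add: centralizer_def conjJ_J matrix_add_ldistrib matrix_add_rdistrib add.commute)

text \<open>Self-adjointness of \<open>conjJ\<close> for the trace form, by cyclicity of the
  trace.\<close>

lemma trace_mult_conjJ: "trace (g ** conjJ x) = trace (conjJ g ** x)"
proof -
  have "g ** conjJ x = (g ** mat (inverse \<beta>)) ** (J ** x ** J)"
    by (simp add: conjJ_def matrix_mul_assoc)
  also have "\<dots> = mat (inverse \<beta>) ** ((g ** J ** x) ** J)"
    by (simp add: mat_commute[symmetric] matrix_mul_assoc)
  finally have "g ** conjJ x = mat (inverse \<beta>) ** ((g ** J ** x) ** J)" .
  then have "trace (g ** conjJ x) = inverse \<beta> * trace (J ** (g ** J ** x))"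
    by (simp only: trace_mat_mult trace_mul_sym[of _ J])
  also have "\<dots> = trace (mat (inverse \<beta>) ** (J ** (g ** J ** x)))" by (simp only: trace_mat_mult)
  also have "mat (inverse \<beta>) ** (J ** (g ** J ** x)) = conjJ g ** x"
    by (simp add: conjJ_def matrix_mul_assoc)
  finally show ?thesis .
qed

text \<open>The eigenspaces of a self-adjoint involution are each other's orthogonals, 2 being
  invertible.\<close>

lemma centralizer_orthogonal_iff:
  "(\<forall>a\<in>centralizer J. trace (g ** a) = 0) \<longleftrightarrow> g ** J = - (J ** g)"
proof
  assume *: "\<forall>a\<in>centralizer J. trace (g ** a) = 0"
  \<comment> \<open>An arbitrary \<open>x\<close> is symmetrized to \<open>x + conjJ x\<close>,
    which lies in the centralizer; self-adjointness moves the symmetrization onto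
    \<open>g\<close>.\<close>
  have "trace ((g + conjJ g) ** x) = trace (0 ** x)" for x
    using bspec[OF * add_conjJ_centralizer[of x]]
    by (simp add: matrix_add_ldistrib matrix_add_rdistrib trace_add trace_mult_conjJ) (simp add: trace_def)
  then have "g + conjJ g = 0" by (rule matrix_eq_if_trace_eq)
  then have "g = - conjJ g" by (simp add: eq_neg_iff_add_eq_0)
  then have "g ** J = - conjJ g ** J" by metis
  then show "g ** J = - (J ** g)" by (simp add: matrix_mult_minus_left conjJ_J)
next
  assume g: "g ** J = - (J ** g)"
  show "\<forall>a\<in>centralizer J. trace (g ** a) = 0"
  proof
    fix a assume a: "a \<in> centralizer J"
    have "conjJ a = mat (inverse \<beta>) ** (a ** (J ** J))"
      using a by (simp add: conjJ_def centralizer_def matrix_mul_assoc)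
    also have "a ** (J ** J) = mat \<beta> ** a" by (simp only: J_square mat_commute)
    also have "mat (inverse \<beta>) ** \<dots> = a" using \<beta> by (simp add: matrix_mul_assoc mat_mult_mat)
    finally have 1: "conjJ a = a" .
    have "conjJ g = mat (inverse \<beta>) ** (J ** (g ** J))"
      by (simp add: conjJ_def matrix_mul_assoc)
    also have "\<dots> = - (mat (inverse \<beta>) ** ((J ** J) ** g))"
      by (simp add: g matrix_mul_assoc matrix_mult_minus_right)
    also have "\<dots> = - g" using \<beta> by (simp add: J_square matrix_mul_assoc mat_mult_mat)
    finally have "trace (g ** a) = - trace (g ** a)"
      using trace_mult_conjJ[of g a] unfolding 1 by (metis matrix_mult_minus_left trace_minus)
    then have "2 * trace (g ** a) = 0" by (simp only: eq_neg_iff_add_eq_0 mult_2)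
    then show "trace (g ** a) = 0" using two by simp
  qed
qed

lemma w_GL: "w \<in> GL" "matrix_inv w = w"
  using matrix_inv_unique_GL[OF w_square] by auto

lemma w_cancel: "w ** (w ** x) = x"
  by (simp add: matrix_mul_assoc w_square)

text \<open>As \<open>w\<close> is invertible and anticommutes with \<open>J\<close>, multiplication
  by \<open>w\<close> exchanges the two eigenspaces of \<open>conjJ\<close>.\<close>

lemma w_mult_centralizer_iff: "w ** x \<in> centralizer J \<longleftrightarrow> x ** J = - (J ** x)"
proof -
  have J: "J ** w = - (w ** J)" by (simp add: anticommute)
  have "w ** x \<in> centralizer J \<longleftrightarrow> w ** (x ** J) = w ** (- (J ** x))"
    by (simp add: centralizer_def matrix_mul_assoc J matrix_mult_minus_left matrix_mult_minus_right)
  also have "\<dots> \<longleftrightarrow> x ** J = - (J ** x)"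
    using w_cancel[of "x ** J"] w_cancel[of "- (J ** x)"] by metis
  finally show ?thesis .
qed

lemma anticommuting_GL_iff:
  assumes "g \<in> GL"
  shows "g ** J = - (J ** g) \<longleftrightarrow> g \<in> left_coset (centralizer J \<inter> GL) w"
proof -
  have "w ** g \<in> GL" using assms w_GL by (simp add: GL_mult)
  then have "w ** g \<in> centralizer J \<longleftrightarrow> w ** g \<in> centralizer J \<inter> GL" by simp
  also have "\<dots> \<longleftrightarrow> g \<in> left_coset (centralizer J \<inter> GL) w"
    unfolding left_coset_def
  proof
    assume "w ** g \<in> centralizer J \<inter> GL"
    then show "g \<in> (\<lambda>h. w ** h) ` (centralizer J \<inter> GL)"
      by (rule image_eqI[rotated]) (simp only: w_cancel)
  next
    assume "g \<in> (\<lambda>h. w ** h) ` (centralizer J \<inter> GL)"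
    then show "w ** g \<in> centralizer J \<inter> GL" by (auto simp only: w_cancel)
  qed
  finally show ?thesis by (simp only: w_mult_centralizer_iff)
qed

text \<open>\<open>chi\<close> is restricted to the normalizer and is \<open>undefined\<close>
  elsewhere, so its value at \<open>w\<close> can be computed only once this is known.\<close>

lemma w_normalizer: "w \<in> normalizer_GL (centralizer J \<inter> GL)"
proof -
  have *: "w ** h ** w \<in> centralizer J \<inter> GL" if "h \<in> centralizer J \<inter> GL" for h
  proof -
    have "(h ** w) ** J = h ** (w ** J)" by (simp add: matrix_mul_assoc)
    also have "\<dots> = - ((h ** J) ** w)" by (simp add: anticommute matrix_mult_minus_right matrix_mul_assoc)
    also have "\<dots> = - (J ** (h ** w))" using that by (simp add: centralizer_def matrix_mul_assoc)
    finally have "w ** (h ** w) \<in> centralizer J" by (simp add: w_mult_centralizer_iff)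
    then show ?thesis using that w_GL by (auto simp: matrix_mul_assoc intro!: GL_mult)
  qed
  have **: "w ** (w ** h ** w) ** w = h" for h
    by (simp add: matrix_mul_assoc w_square) (simp add: w_square flip: matrix_mul_assoc)
  have "(\<lambda>h. w ** h ** w) ` (centralizer J \<inter> GL) = centralizer J \<inter> GL"
  proof
    show "(\<lambda>h. w ** h ** w) ` (centralizer J \<inter> GL) \<subseteq> centralizer J \<inter> GL"
      using * by blast
    show "centralizer J \<inter> GL \<subseteq> (\<lambda>h. w ** h ** w) ` (centralizer J \<inter> GL)"
    proof
      fix x assume "x \<in> centralizer J \<inter> GL"
      then show "x \<in> (\<lambda>h. w ** h ** w) ` (centralizer J \<inter> GL)"
        by (intro image_eqI[of _ _ "w ** x ** w"] *) (simp only: **)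
    qed
  qed
  then show ?thesis by (simp add: normalizer_GL_def w_GL)
qed

text \<open>The matrix space is the direct sum of the eigenspaces A and w A of \<open>conjJ\<close>,
  which have equally many elements. Thus |A| is the square root of the number of matrices that
  normalizes the gamma factor.\<close>

lemma card_centralizer: "(card (centralizer J))\<^sup>2 = CARD('k) ^ (CARD('n) * CARD('n))"
proof -
  let ?f = "\<lambda>(a, b). a + w ** b"
  have "inj_on ?f (centralizer J \<times> centralizer J)"
  proof (rule inj_onI, clarify)
    fix a b a' b' assume A: "a \<in> centralizer J" "b \<in> centralizer J" "a' \<in> centralizer J" "b' \<in> centralizer J"
      and e: "a + w ** b = a' + w ** b'"
    have w1: "w ** x ** J = - (J ** (w ** x))" if "x \<in> centralizer J" for x
      using that w_mult_centralizer_iff[of "w ** x"] by (simp add: w_cancel)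
    \<comment> \<open>\<open>d\<close> lies in both A and w A, so it commutes and anticommutes with
      \<open>J\<close>; hence d J = 0, and multiplying by the inverse of \<open>J\<close> gives d =
      0.\<close>
    define d where "d = a - a'"
    have d2: "d = w ** b' - w ** b" using e by (simp add: d_def algebra_simps)
    have "d ** J = J ** d" using A unfolding d_def
      by (simp add: centralizer_def matrix_diff_ldistrib matrix_diff_rdistrib)
    moreover have "d ** J = - (J ** d)" using A unfolding d2
      by (simp add: w1 matrix_diff_ldistrib matrix_diff_rdistrib)
    ultimately have "d ** J = - (d ** J)" by metis
    then have "d ** J = 0" by (rule matrix_eq_minus_self[OF two])
    then have "(d ** J) ** (J ** mat (inverse \<beta>)) = 0" by (simp add: matrix_matrix_mult_def vec_eq_iff)
    moreover have "(d ** J) ** (J ** mat (inverse \<beta>)) = d ** ((J ** J) ** mat (inverse \<beta>))"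
      by (simp only: matrix_mul_assoc)
    ultimately have "d = 0" using \<beta> by (simp add: J_square mat_mult_mat)
    then have aa: "a = a'" by (simp add: d_def)
    then have "w ** (w ** b) = w ** (w ** b')" using e by simp
    then show "a = a' \<and> b = b'" using aa by (simp only: w_cancel)
  qed
  moreover have "?f ` (centralizer J \<times> centralizer J) = UNIV"
  proof -
    have "x \<in> ?f ` (centralizer J \<times> centralizer J)" for x
    proof -
      \<comment> \<open>\<open>a\<close> and \<open>y\<close> are the projections of
        \<open>x\<close> to the two eigenspaces.\<close>
      define a where "a = mat (inverse 2) ** (x + conjJ x)"
      define y where "y = mat (inverse 2) ** (x - conjJ x)"
      have "a \<in> centralizer J" unfolding a_def
        by (intro centralizer_mult centralizer_mat add_conjJ_centralizer)
      moreover have "y ** J = - (J ** y)"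
      proof -
        have "y ** J = mat (inverse 2) ** ((x - conjJ x) ** J)" by (simp add: y_def matrix_mul_assoc)
        also have "(x - conjJ x) ** J = - (J ** (x - conjJ x))"
          by (simp add: matrix_diff_ldistrib matrix_diff_rdistrib conjJ_J)
        also have "mat (inverse 2) ** (- (J ** (x - conjJ x))) = - ((mat (inverse 2) ** J) ** (x - conjJ x))"
          by (simp only: matrix_mult_minus_right matrix_mul_assoc)
        also have "mat (inverse 2) ** J = J ** mat (inverse 2)" by (rule mat_commute)
        also have "- (J ** mat (inverse 2) ** (x - conjJ x)) = - (J ** y)"
          by (simp only: y_def matrix_mul_assoc)
        finally show ?thesis .
      qed
      then have "w ** y \<in> centralizer J" by (simp only: w_mult_centralizer_iff)
      moreover have "x = a + w ** (w ** y)"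
      proof -
        have "a + y = mat (inverse 2) ** (x + x)"
          unfolding a_def y_def matrix_add_ldistrib[symmetric] by simp
        also have "x + x = mat 2 ** x"
          by (simp add: vec_eq_iff matrix_matrix_mult_def mat_def if_distrib[of "\<lambda>x. x * _"] cong: if_cong)
        also have "mat (inverse 2) ** (mat 2 ** x) = x"
          using two by (simp add: matrix_mul_assoc mat_mult_mat)
        finally show ?thesis by (simp only: w_cancel)
      qed
      ultimately show ?thesis by (intro image_eqI[of _ _ "(a, w ** y)"]) auto
    qed
    then show ?thesis by auto
  qed
  ultimately have "card (centralizer J \<times> centralizer J) = CARD('k^'n^'n)"
    by (metis card_image)
  then show ?thesis by (simp add: card_cartesian_product power2_eq_square flip: power_mult)
qed

end

text \<open>Orthogonality of characters for the linear form \<open>t\<close> on A; scalars act as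
  the matrices \<open>mat c\<close>. If \<open>t\<close> is not zero on A, it takes every value
  there, and translation by a suitable element multiplies the sum by a factor other than 1.\<close>

lemma sum_character_subspace:
  fixes \<psi> :: "'k::field \<Rightarrow> 'r::field" and t :: "'k^'n^'n \<Rightarrow> 'k"
  assumes \<psi>: "nontrivial_additive_character \<psi>" and A: "finite A"
    and add: "\<And>a b. a \<in> A \<Longrightarrow> b \<in> A \<Longrightarrow> a + b \<in> A" and scale: "\<And>c a. a \<in> A \<Longrightarrow> mat c ** a \<in> A"
    and t_add: "\<And>a b. t (a + b) = t a + t b" and t_scale: "\<And>c a. t (mat c ** a) = c * t a"
  shows "(\<Sum>a\<in>A. \<psi> (t a)) = (if \<forall>a\<in>A. t a = 0 then of_nat (card A) else 0)"
proof (cases "\<forall>a\<in>A. t a = 0")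
  case True
  have "\<psi> 0 = 1" using \<psi> unfolding nontrivial_additive_character_def
    by (metis add.right_neutral mult_cancel_left mult.right_neutral)
  then show ?thesis using True by simp
next
  case False
  then obtain b where b: "b \<in> A" "t b \<noteq> 0" by auto
  obtain x where x: "\<psi> x \<noteq> 1" using \<psi> by (auto simp: nontrivial_additive_character_def)
  define a0 where "a0 = mat (x / t b) ** b"
  have a0: "a0 \<in> A" "t a0 = x" using b scale by (auto simp: a0_def t_scale)
  have "(\<lambda>a. a + a0) ` A = A"
    using A a0 add by (intro endo_inj_surj) (auto simp: inj_on_def)
  then have "(\<Sum>a\<in>A. \<psi> (t a)) = (\<Sum>a\<in>(\<lambda>a. a + a0) ` A. \<psi> (t a))" by simp
  also have "\<dots> = (\<Sum>a\<in>A. \<psi> (t (a + a0)))" by (subst sum.reindex) (auto simp: inj_on_def)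
  also have "\<dots> = (\<Sum>a\<in>A. \<psi> (t a)) * \<psi> x"
    using \<psi> by (simp add: t_add a0 nontrivial_additive_character_def sum_distrib_right)
  finally show ?thesis using x False by auto
qed

section \<open>Representations\<close>

locale gl_rep =
  fixes sc :: "'r::field \<Rightarrow> 'v::ab_group_add \<Rightarrow> 'v"
    and \<pi> :: "'k::{field,finite}^'n^'n \<Rightarrow> 'v \<Rightarrow> 'v"
  assumes rep: "is_rep sc \<pi>"
begin

sublocale vector_space sc
  using rep by (simp add: is_rep_def)

lemma rep_linear: "g \<in> GL \<Longrightarrow> Vector_Spaces.linear sc sc (\<pi> g)"
  using rep by (simp add: is_rep_def)

lemma rep_add: "g \<in> GL \<Longrightarrow> \<pi> g (x + y) = \<pi> g x + \<pi> g y"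
  and rep_scale: "g \<in> GL \<Longrightarrow> \<pi> g (sc c x) = sc c (\<pi> g x)"
  and rep_diff: "g \<in> GL \<Longrightarrow> \<pi> g (x - y) = \<pi> g x - \<pi> g y"
  and rep_sum: "g \<in> GL \<Longrightarrow> \<pi> g (\<Sum>i\<in>I. f i) = (\<Sum>i\<in>I. \<pi> g (f i))"
proof -
  assume "g \<in> GL"
  then interpret l: Vector_Spaces.linear sc sc "\<pi> g" by (rule rep_linear)
  show "\<pi> g (x + y) = \<pi> g x + \<pi> g y" "\<pi> g (sc c x) = sc c (\<pi> g x)" "\<pi> g (x - y) = \<pi> g x - \<pi> g y"
    "\<pi> g (\<Sum>i\<in>I. f i) = (\<Sum>i\<in>I. \<pi> g (f i))"
    by (rule l.add l.scale l.diff l.sum)+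
qed

lemma rep_mult: "g \<in> GL \<Longrightarrow> h \<in> GL \<Longrightarrow> \<pi> g (\<pi> h v) = \<pi> (g ** h) v"
  using rep by (simp add: is_rep_def)

lemma rep_1: "\<pi> (mat 1) v = v"
  using rep by (simp add: is_rep_def)

lemma dual_linear: "\<Lambda> \<in> dual_space sc \<Longrightarrow> Vector_Spaces.linear sc (*) \<Lambda>"
  by (simp add: dual_space_def)

lemma dual_add: "\<Lambda> \<in> dual_space sc \<Longrightarrow> \<Lambda> (x + y) = \<Lambda> x + \<Lambda> y"
  and dual_scale: "\<Lambda> \<in> dual_space sc \<Longrightarrow> \<Lambda> (sc c x) = c * \<Lambda> x"
  and dual_diff: "\<Lambda> \<in> dual_space sc \<Longrightarrow> \<Lambda> (x - y) = \<Lambda> x - \<Lambda> y"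
  and dual_sum: "\<Lambda> \<in> dual_space sc \<Longrightarrow> \<Lambda> (\<Sum>i\<in>I. f i) = (\<Sum>i\<in>I. \<Lambda> (f i))"
  and dual_0: "\<Lambda> \<in> dual_space sc \<Longrightarrow> \<Lambda> 0 = 0"
proof -
  assume "\<Lambda> \<in> dual_space sc"
  then interpret l: Vector_Spaces.linear sc "(*)" \<Lambda> by (rule dual_linear)
  show "\<Lambda> (x + y) = \<Lambda> x + \<Lambda> y" "\<Lambda> (sc c x) = c * \<Lambda> x" "\<Lambda> (x - y) = \<Lambda> x - \<Lambda> y" "\<Lambda> 0 = 0"
    "\<Lambda> (\<Sum>i\<in>I. f i) = (\<Sum>i\<in>I. \<Lambda> (f i))"
    by (rule l.add l.scale l.diff l.sum l.zero)+
qed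

lemma dualI:
  assumes "\<And>x y. \<Lambda> (x + y) = \<Lambda> x + \<Lambda> y" "\<And>c x. \<Lambda> (sc c x) = c * \<Lambda> x"
  shows "\<Lambda> \<in> dual_space sc"
  unfolding dual_space_def mem_Collect_eq
  by unfold_locales (simp_all add: assms algebra_simps)

section \<open>Functionals extended to the algebraic closure\<close>

definition ext_functional :: "('v \<Rightarrow> 'r) \<Rightarrow> ('v \<Rightarrow>\<^sub>0 'r alg_closure) \<Rightarrow> 'r alg_closure" where
  "ext_functional \<Lambda> f = (\<Sum>b\<in>Poly_Mapping.keys f. Poly_Mapping.lookup f b * to_ac (\<Lambda> b))"

lemma lookup_ext_scale: "Poly_Mapping.lookup (ext_scale c f) b = c * Poly_Mapping.lookup f b"
  by (simp add: ext_scale_def Poly_Mapping.map.rep_eq when_def)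

lemma module_ext_scale: "Modules.module (ext_scale :: 'l::field \<Rightarrow> ('v \<Rightarrow>\<^sub>0 'l) \<Rightarrow> _)"
  by unfold_locales (auto intro!: poly_mapping_eqI simp: lookup_ext_scale lookup_add algebra_simps)

lemma ext_functional_superset:
  assumes "finite S" "Poly_Mapping.keys f \<subseteq> S"
  shows "ext_functional \<Lambda> f = (\<Sum>b\<in>S. Poly_Mapping.lookup f b * to_ac (\<Lambda> b))"
  unfolding ext_functional_def
  by (rule sum.mono_neutral_left) (use assms in \<open>auto simp: in_keys_iff\<close>)

lemma ext_functional_add: "ext_functional \<Lambda> (f + g) = ext_functional \<Lambda> f + ext_functional \<Lambda> g"
proof -
  let ?S = "Poly_Mapping.keys f \<union> Poly_Mapping.keys g"
  have "Poly_Mapping.keys (f + g) \<subseteq> ?S" by (rule Poly_Mapping.keys_add)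
  then show ?thesis
    by (simp add: ext_functional_superset[of ?S] lookup_add distrib_right sum.distrib)
qed

lemma ext_functional_scale: "ext_functional \<Lambda> (ext_scale c f) = c * ext_functional \<Lambda> f"
proof -
  have "Poly_Mapping.keys (ext_scale c f) \<subseteq> Poly_Mapping.keys f"
    by (auto simp: in_keys_iff lookup_ext_scale)
  then show ?thesis
    by (simp add: ext_functional_superset[of "Poly_Mapping.keys f"] lookup_ext_scale sum_distrib_left mult.assoc)
qed

lemma ext_functional_zero: "ext_functional \<Lambda> 0 = 0"
  by (simp add: ext_functional_def)

lemma ext_functional_sum: "ext_functional \<Lambda> (\<Sum>i\<in>I. f i) = (\<Sum>i\<in>I. ext_functional \<Lambda> (f i))"
  by (induction I rule: infinite_finite_induct) (simp_all add: ext_functional_add ext_functional_zero)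

lemma ext_basis: "independent (ext_basis sc)" "span (ext_basis sc) = UNIV"
  unfolding ext_basis_def
  by (rule independent_extend_basis span_extend_basis, rule independent_empty)+

lemma lookup_ext_vec:
  "Poly_Mapping.lookup (ext_vec sc v) b = to_ac (representation (ext_basis sc) v b)"
proof -
  let ?x = "representation (ext_basis sc) v"
  have "Poly_Mapping.lookup (ext_vec sc v) b = (\<Sum>c | ?x c \<noteq> 0. if c = b then to_ac (?x c) else 0)"
    unfolding ext_vec_def Let_def by (simp add: lookup_sum lookup_single when_def)
  also have "\<dots> = to_ac (?x b)"
    using finite_representation by (subst sum.delta) auto
  finally show ?thesis .
qed

lemma ext_vec_space: "ext_vec sc v \<in> ext_space sc"
  using representation_ne_zero by (auto simp: ext_space_def in_keys_iff lookup_ext_vec)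

lemma ext_space_subspace:
  "0 \<in> ext_space sc"
  "f \<in> ext_space sc \<Longrightarrow> g \<in> ext_space sc \<Longrightarrow> f + g \<in> ext_space sc"
  "f \<in> ext_space sc \<Longrightarrow> ext_scale c f \<in> ext_space sc"
  using keys_add[of f g] by (auto simp: ext_space_def in_keys_iff lookup_ext_scale)

lemma ext_action_space: "ext_action sc \<pi> g f \<in> ext_space sc"
proof -
  have "(\<Sum>b\<in>I. ext_scale (c b) (ext_vec sc (\<pi> g b))) \<in> ext_space sc" for I c
    by (induction I rule: infinite_finite_induct) (simp_all add: ext_space_subspace ext_vec_space)
  then show ?thesis by (simp add: ext_action_def)
qed

text \<open>The coordinate formula \<open>ext_functional\<close> is the extension of \<Lambda> to L
  \<otimes> V: expanding \<open>v\<close> in the chosen basis, its value at 1 \<otimes> v is that of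
  \<Lambda> at \<open>v\<close>.\<close>

lemma ext_functional_ext_vec:
  assumes "\<Lambda> \<in> dual_space sc"
  shows "ext_functional \<Lambda> (ext_vec sc v) = to_ac (\<Lambda> v)"
proof -
  let ?x = "representation (ext_basis sc) v"
  have "ext_functional \<Lambda> (ext_vec sc v) = (\<Sum>b | ?x b \<noteq> 0. to_ac (?x b) * to_ac (\<Lambda> b))"
    by (subst ext_functional_superset[of "{b. ?x b \<noteq> 0}"])
      (auto simp: finite_representation in_keys_iff lookup_ext_vec)
  also have "\<dots> = to_ac (\<Lambda> (\<Sum>b | ?x b \<noteq> 0. sc (?x b) b))"
    by (simp add: dual_sum dual_scale assms to_ac_sum)
  also have "(\<Sum>b | ?x b \<noteq> 0. sc (?x b) b) = v"
    by (rule sum_nonzero_representation_eq) (simp_all add: ext_basis)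
  finally show ?thesis .
qed

lemma ext_functional_ext_action:
  assumes "\<Lambda> \<in> dual_space sc"
  shows "ext_functional \<Lambda> (ext_action sc \<pi> g f) = ext_functional (\<lambda>v. \<Lambda> (\<pi> g v)) f"
  by (simp add: ext_action_def ext_functional_sum ext_functional_scale ext_functional_ext_vec assms)
    (simp add: ext_functional_def)

text \<open>Irreducibility over the base field in dual form; the extended functionals cut out a
  subrepresentation over the algebraic closure.\<close>

lemma stable_functionals:
  assumes irr: "absolutely_irreducible sc \<pi>"
    and F: "F \<subseteq> dual_space sc" and stable: "\<And>\<Lambda> g. \<Lambda> \<in> F \<Longrightarrow> g \<in> GL \<Longrightarrow> (\<lambda>v. \<Lambda> (\<pi> g v)) \<in> F"
  shows "(\<forall>\<Lambda>\<in>F. \<forall>v. \<Lambda> v = 0) \<or> (\<forall>v. (\<forall>\<Lambda>\<in>F. \<Lambda> v = 0) \<longrightarrow> v = 0)"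
proof -
  define W where "W = {f \<in> ext_space sc. \<forall>\<Lambda>\<in>F. ext_functional \<Lambda> f = 0}"
  have "module.subspace ext_scale W"
    unfolding Modules.module.subspace_def[OF module_ext_scale] W_def
    by (auto simp: ext_space_subspace ext_functional_add ext_functional_scale ext_functional_zero)
  moreover have "ext_action sc \<pi> g f \<in> W" if "g \<in> GL" "f \<in> W" for g f
    using that stable F by (auto simp: W_def ext_action_space ext_functional_ext_action subset_iff)
  moreover have "W \<subseteq> ext_space sc" by (auto simp: W_def)
  ultimately consider "W = {0}" | "W = ext_space sc"
    using irr unfolding absolutely_irreducible_def irreducible_action_def by blast
  then show ?thesis
  proof cases
    case 1
    \<comment> \<open>A vector killed by \<open>F\<close> yields an element 1 \<otimes> v of
      \<open>W\<close>, so its coordinates vanish in L, hence already in R.\<close>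
    have "v = 0" if "\<forall>\<Lambda>\<in>F. \<Lambda> v = 0" for v
    proof -
      have "ext_vec sc v \<in> W"
        using that F by (auto simp: W_def ext_vec_space ext_functional_ext_vec subset_iff)
      then have "ext_vec sc v = 0" using 1 by simp
      then have "representation (ext_basis sc) v b = 0" for b
        using lookup_ext_vec[of v b] by simp
      then show "v = 0"
        using sum_nonzero_representation_eq[of "ext_basis sc" v] ext_basis by simp
    qed
    then show ?thesis by blast
  next
    case 2
    have "\<Lambda> v = 0" if "\<Lambda> \<in> F" for \<Lambda> v
    proof -
      have "ext_vec sc v \<in> W" using 2 ext_vec_space by simp
      then show ?thesis using that F by (auto simp: W_def ext_functional_ext_vec subset_iff)
    qed
    then show ?thesis by blast
  qed
qed

section \<open>Invariant functionals of a cuspidal representation\<close>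

lemma coinvariant_functional_zero:
  assumes "coinvariant_kernel sc \<pi> U = UNIV" and L: "\<Lambda> \<in> dual_space sc"
    and inv: "\<And>u v. u \<in> U \<Longrightarrow> \<Lambda> (\<pi> u v) = \<Lambda> v"
  shows "\<Lambda> v = 0"
proof -
  have "subspace {v. \<Lambda> v = 0}"
    using L by (auto simp: subspace_def dual_add dual_scale dual_0)
  then have "span {\<pi> u v - v | u v. u \<in> U} \<subseteq> {v. \<Lambda> v = 0}"
    by (intro span_minimal) (auto simp: dual_diff L inv)
  then show ?thesis using assms(1) by (auto simp: coinvariant_kernel_def)
qed

text \<open>For \<open>u\<close> in a unipotent radical with \<open>u - 1\<close> mapping into
  \<open>W\<close>, every \<open>a\<close> with kernel \<open>W\<close> satisfies a u = a, so by
  cyclicity the weight is unchanged when g becomes u^-1 g. This change of variables on G/H shows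
  that the sum, as a functional of \<open>v\<close>, is invariant under the radical; it then factors
  through vanishing coinvariants.\<close>

lemma coset_sum_kernel_zero:
  assumes cusp: "cuspidal sc \<pi>" and n: "CARD('n) \<ge> 2"
    and A: "\<And>a b. a \<in> A \<Longrightarrow> b \<in> A \<Longrightarrow> a ** b \<in> A"
    and H: "matrix_subgroup H" "H \<subseteq> A" and L: "\<Lambda> \<in> Hom_triv sc \<pi> H"
    and W: "vec.subspace W" "W \<noteq> {0}"
  shows "coset_sum H (\<lambda>g. (\<Sum>a | a \<in> A \<and> {x. a *v x = 0} = W. \<psi> (trace (g ** a))) *
           \<Lambda> (\<pi> (matrix_inv g) v)) = 0"
proof -
  define Y where "Y = {a. a \<in> A \<and> {x. a *v x = 0} = W}"
  define f where "f g = (\<Sum>a\<in>Y. \<psi> (trace (g ** a)))" for g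
  define T where "T v = coset_sum H (\<lambda>g. f g * \<Lambda> (\<pi> (matrix_inv g) v))" for v
  have L': "\<Lambda> \<in> dual_space sc" and LH: "\<And>h v. h \<in> H \<Longrightarrow> \<Lambda> (\<pi> h v) = \<Lambda> v"
    using L by (auto simp: Hom_triv_def)
  have HG: "H \<subseteq> GL" using H by (auto simp: matrix_subgroup_def)
  obtain Ws where Ws: "is_flag Ws" "parabolic Ws \<noteq> GL"
    and u: "\<And>u x. u \<in> unipotent_radical Ws \<Longrightarrow> u *v x - x \<in> W"
    using exists_unipotent_radical[OF W n] by blast
  have "T \<in> dual_space sc"
  proof (rule dualI)
    show "T (x + y) = T x + T y" for x y
      unfolding T_def coset_sum_def sum.distrib[symmetric]
      by (rule sum.cong) (auto simp: coset_rep rep_add matrix_inv_GL dual_add L' distrib_left)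
    show "T (sc c x) = c * T x" for c x
      unfolding T_def coset_sum_def sum_distrib_left
      by (rule sum.cong) (auto simp: coset_rep rep_scale matrix_inv_GL dual_scale L' mult_ac)
  qed
  moreover have "T (\<pi> u v) = T v" if uU: "u \<in> unipotent_radical Ws" for u v
  proof -
    have uG: "u \<in> GL" using uU by (auto simp: unipotent_radical_def parabolic_def)
    have "a ** u = a" if "a \<in> Y" for a
    proof -
      have "a *v (u *v x - x) = 0" for x using u[OF uU, of x] that by (auto simp: Y_def)
      then have "a *v (u *v x) = a *v x" for x by (simp add: matrix_vector_mult_diff_distrib)
      then show ?thesis by (simp add: matrix_eq matrix_vector_mul_assoc)
    qed
    then have au: "a ** matrix_inv u = a" if "a \<in> Y" for a
      using GL_cancel_right(1)[OF uG, of a] that by simp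
    have fu: "f (matrix_inv u ** g) = f g" for g
    proof -
      have "trace (matrix_inv u ** g ** a) = trace (g ** a)" if "a \<in> Y" for a
        using trace_mul_sym[of "matrix_inv u" "g ** a"] au[OF that]
        by (simp add: matrix_mul_assoc[symmetric])
      then show ?thesis by (simp add: f_def)
    qed
    have "right_invariant H (\<lambda>g. f g * \<Lambda> (\<pi> (matrix_inv g) v))"
      unfolding right_invariant_def
    proof (intro ballI)
      fix g h :: "'k^'n^'n" assume g: "g \<in> GL" and h: "h \<in> H"
      then have hG: "h \<in> GL" and hi: "matrix_inv h \<in> H" "h \<in> A" "matrix_inv h \<in> A"
        using HG H by (auto simp: matrix_subgroup_def)
      \<comment> \<open>An invertible left factor does not change the kernel, so \<open>H\<close>
        permutes \<open>Y\<close>. This makes the weight \<open>f\<close> right invariant and the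
        coset sum independent of representatives.\<close>
      have Y: "k ** a \<in> Y" if "k \<in> H" "a \<in> Y" for k a
      proof -
        have kG: "k \<in> GL" using that HG by auto
        have "k *v y = 0 \<longleftrightarrow> y = 0" for y using kG[unfolded GL_iff_ker] by auto
        then show ?thesis using that A H
          by (auto simp: Y_def simp flip: matrix_vector_mul_assoc)
      qed
      have "f (g ** h) = f g" unfolding f_def
        by (rule sum.reindex_bij_witness[of _ "\<lambda>a. matrix_inv h ** a" "\<lambda>a. h ** a"])
          (use h hi Y hG in \<open>auto simp: GL_matrix_inv matrix_mul_assoc\<close>)
      moreover have "\<Lambda> (\<pi> (matrix_inv (g ** h)) v) = \<Lambda> (\<pi> (matrix_inv g) v)"
        using LH[OF hi(1)] g hG by (simp add: matrix_inv_mult_GL matrix_inv_GL flip: rep_mult)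
      ultimately show "f (g ** h) * \<Lambda> (\<pi> (matrix_inv (g ** h)) v) = f g * \<Lambda> (\<pi> (matrix_inv g) v)"
        by simp
    qed
    from coset_sum_translate[OF H(1) this matrix_inv_GL[OF uG]]
    have "T v = coset_sum H (\<lambda>g. f (matrix_inv u ** g) * \<Lambda> (\<pi> (matrix_inv (matrix_inv u ** g)) v))"
      by (simp add: T_def)
    also have "\<dots> = T (\<pi> u v)" unfolding T_def
      by (rule coset_sum_cong)
        (simp add: fu matrix_inv_mult_GL matrix_inv_inv_GL matrix_inv_GL uG rep_mult)
    finally show ?thesis by simp
  qed
  moreover have "coinvariant_kernel sc \<pi> (unipotent_radical Ws) = UNIV"
    using cusp Ws by (simp add: cuspidal_def)
  ultimately have "T v = 0" using coinvariant_functional_zero by blast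
  then show ?thesis by (simp add: T_def f_def Y_def)
qed

end

section \<open>The Gauss sum operator\<close>

lemma coset_sum_sum:
  fixes F :: "'i \<Rightarrow> 'k::{field,finite}^'n^'n \<Rightarrow> 'r::comm_ring_1"
  shows "coset_sum H (\<lambda>g. \<Sum>i\<in>I. F i g) = (\<Sum>i\<in>I. coset_sum H (F i))"
  unfolding coset_sum_def by (rule sum.swap)

context gl_rep
begin

text \<open>The transpose of the operator on the dual that defines the gamma factor, which is why
  \<pi> is taken at the inverse of \<open>g\<close>.\<close>

definition gauss_op :: "('k \<Rightarrow> 'r) \<Rightarrow> 'v \<Rightarrow> 'v" where
  "gauss_op \<psi> v = (\<Sum>g\<in>GL. sc (\<psi> (trace g)) (\<pi> (matrix_inv g) v))"

lemma gauss_op_add: "gauss_op \<psi> (x + y) = gauss_op \<psi> x + gauss_op \<psi> y"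
  by (simp add: gauss_op_def rep_add matrix_inv_GL scale_right_distrib sum.distrib)

lemma gauss_op_scale: "gauss_op \<psi> (sc c x) = sc c (gauss_op \<psi> x)"
  by (simp add: gauss_op_def rep_scale matrix_inv_GL scale_sum_right mult.commute)

lemma dual_gauss_op:
  assumes "\<Lambda> \<in> dual_space sc"
  shows "\<Lambda> (gauss_op \<psi> v) = (\<Sum>g\<in>GL. \<psi> (trace g) * \<Lambda> (\<pi> (matrix_inv g) v))"
  by (simp add: gauss_op_def dual_sum dual_scale assms)

lemma gauss_op_rep:
  assumes h: "h \<in> GL"
  shows "gauss_op \<psi> (\<pi> h v) = \<pi> h (gauss_op \<psi> v)"
proof -
  let ?h = "matrix_inv h"
  have hi: "?h \<in> GL" using h by (rule matrix_inv_GL)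
  have "\<pi> h (gauss_op \<psi> v) = (\<Sum>g\<in>GL. sc (\<psi> (trace g)) (\<pi> (h ** matrix_inv g) v))"
    by (simp add: gauss_op_def rep_sum rep_scale rep_mult h matrix_inv_GL)
  also have "\<dots> = (\<Sum>g\<in>GL. sc (\<psi> (trace g)) (\<pi> (matrix_inv g ** h) v))"
  \<comment> \<open>Substitution of h g h^-1 for g, under which the trace is invariant.\<close>
  proof (rule sum.reindex_bij_witness[of _ "\<lambda>g. ?h ** g ** h" "\<lambda>g. h ** g ** ?h"])
    fix g :: "'k^'n^'n" assume g: "g \<in> GL"
    show "h ** (?h ** g ** h) ** ?h = g" "?h ** (h ** g ** ?h) ** h = g"
      by (simp_all add: GL_cancel_left GL_cancel_right GL_matrix_inv h flip: matrix_mul_assoc)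
    show "?h ** g ** h \<in> GL" "h ** g ** ?h \<in> GL" using g h hi by (auto intro!: GL_mult)
    have "trace (h ** g ** ?h) = trace g"
      using trace_mul_sym[of "h ** g" ?h] by (simp add: GL_cancel_left h)
    moreover have "matrix_inv (h ** g ** ?h) ** h = h ** matrix_inv g"
      using g h hi by (simp add: matrix_inv_mult_GL GL_mult matrix_inv_inv_GL GL_matrix_inv
          flip: matrix_mul_assoc)
    ultimately show "sc (\<psi> (trace (h ** g ** ?h))) (\<pi> (matrix_inv (h ** g ** ?h) ** h) v) =
        sc (\<psi> (trace g)) (\<pi> (h ** matrix_inv g) v)" by simp
  qed
  also have "\<dots> = gauss_op \<psi> (\<pi> h v)"
    by (simp add: gauss_op_def rep_mult h matrix_inv_GL)
  finally show ?thesis by simp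
qed

lemma gauss_op_Hom_triv:
  assumes cusp: "cuspidal sc \<pi>" and n: "CARD('n) \<ge> 2"
    and pair: "anticommuting_pair J w \<beta>" and \<psi>: "nontrivial_additive_character \<psi>"
    and L: "\<Lambda> \<in> Hom_triv sc \<pi> (centralizer J \<inter> GL)"
  shows "\<Lambda> (gauss_op \<psi> v) = of_nat (card (centralizer J)) * \<Lambda> (\<pi> w v)"
proof -
  interpret anticommuting_pair J w \<beta> by (rule pair)
  define A where "A = centralizer J"
  define H where "H = A \<inter> GL"
  define F where "F g = \<Lambda> (\<pi> (matrix_inv g) v)" for g
  define ker :: "'k^'n^'n \<Rightarrow> ('k^'n) set" where "ker a = {x. a *v x = 0}" for a
  define s where "s = (of_nat (card A) :: 'r)"
  have H: "matrix_subgroup H" "H \<subseteq> A"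
    by (auto simp: H_def A_def matrix_subgroup_centralizer)
  have L': "\<Lambda> \<in> dual_space sc" and LH: "\<And>h v. h \<in> H \<Longrightarrow> \<Lambda> (\<pi> h v) = \<Lambda> v"
    using L by (auto simp: Hom_triv_def H_def A_def)
  have Finv: "F (g ** h) = F g" if "g \<in> GL" "h \<in> H" for g h
  proof -
    have "h \<in> GL" "matrix_inv h \<in> H" using that H by (auto simp: H_def matrix_subgroup_def)
    then show ?thesis using that LH[of "matrix_inv h" "\<pi> (matrix_inv g) v"]
      by (simp add: F_def matrix_inv_mult_GL matrix_inv_GL rep_mult)
  qed
  define S where "S W = coset_sum H (\<lambda>g. (\<Sum>a | a \<in> A \<and> ker a = W. \<psi> (trace (g ** a))) * F g)" for W
  have "\<Lambda> (gauss_op \<psi> v) = (\<Sum>g\<in>GL. \<psi> (trace g) * F g)"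
    by (simp add: dual_gauss_op L' F_def)
  also have "\<dots> = coset_sum H (\<lambda>g. \<Sum>h\<in>H. \<psi> (trace (g ** h)) * F (g ** h))"
    by (rule sum_GL_eq_coset_sum[OF H(1)])
  also have "\<dots> = S {0}"
    unfolding S_def
  proof (rule coset_sum_cong)
    fix g :: "'k^'n^'n" assume g: "g \<in> GL"
    \<comment> \<open>The invertible elements of A are those with zero kernel, so the sum over
      \<open>H\<close> is the stratum W = {0} of A.\<close>
    have ker_0: "{a. a \<in> A \<and> ker a = {0}} = H"
      unfolding H_def ker_def GL_iff_ker[symmetric] by blast
    show "(\<Sum>h\<in>H. \<psi> (trace (g ** h)) * F (g ** h)) =
        (\<Sum>a | a \<in> A \<and> ker a = {0}. \<psi> (trace (g ** a))) * F g"
      unfolding ker_0 sum_distrib_right by (rule sum.cong) (simp_all add: Finv g)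
  qed
  \<comment> \<open>The strata with nonzero kernel contribute 0 by cuspidality and may be
    added.\<close>
  also have "\<dots> = (\<Sum>W\<in>ker ` A. S W)"
  proof -
    have "S W = 0" if "W \<in> ker ` A" "W \<noteq> {0}" for W
      unfolding S_def F_def ker_def
    proof (rule coset_sum_kernel_zero[OF cusp n _ H])
      show "a ** b \<in> A" if "a \<in> A" "b \<in> A" for a b
        using that by (auto simp: A_def centralizer_mult)
      show "vec.subspace W" using that(1)
        by (auto simp: ker_def vec.subspace_def matrix_vector_right_distrib vector_scalar_commute)
    qed (use that L in \<open>auto simp: H_def A_def\<close>)
    moreover have "{0} \<in> ker ` A"
      by (rule image_eqI[of _ _ "mat 1"]) (auto simp: ker_def A_def centralizer_mat)
    ultimately show ?thesis
      by (simp add: sum.remove[of _ "{0}"])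
  qed
  also have "\<dots> = coset_sum H (\<lambda>g. (\<Sum>a\<in>A. \<psi> (trace (g ** a))) * F g)"
    unfolding S_def coset_sum_sum[symmetric]
    by (rule coset_sum_cong)
      (simp add: sum_distrib_right[symmetric] sum.group[of A "ker ` A" ker, simplified])
  \<comment> \<open>The complete character sum is |A| when \<open>g\<close> is orthogonal to A and 0
    otherwise; the invertible elements orthogonal to A form the single coset of
    \<open>w\<close>.\<close>
  also have "\<dots> = coset_sum H (\<lambda>g. if g \<in> left_coset H w then s * F g else 0)"
  proof (rule coset_sum_cong)
    fix g :: "'k^'n^'n" assume g: "g \<in> GL"
    have "(\<Sum>a\<in>A. \<psi> (trace (g ** a))) =
        (if \<forall>a\<in>A. trace (g ** a) = 0 then of_nat (card A) else 0)"
    proof (rule sum_character_subspace[OF \<psi>])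
      show "trace (g ** (mat c ** a)) = c * trace (g ** a)" for c a
      proof -
        have "g ** (mat c ** a) = mat c ** (g ** a)"
          by (simp only: matrix_mul_assoc mat_commute[of c g])
        then show ?thesis by (simp add: trace_mat_mult)
      qed
    qed (auto simp: A_def centralizer_add centralizer_mult centralizer_mat matrix_add_ldistrib trace_add)
    also have "(\<forall>a\<in>A. trace (g ** a) = 0) \<longleftrightarrow> g \<in> left_coset H w"
      using g by (simp add: A_def H_def centralizer_orthogonal_iff anticommuting_GL_iff)
    finally show "(\<Sum>a\<in>A. \<psi> (trace (g ** a))) * F g =
        (if g \<in> left_coset H w then s * F g else 0)" by (simp add: s_def)
  qed
  also have "\<dots> = s * F w"
    by (rule coset_sum_indicator[OF H(1) _ w_GL(1)]) (simp add: right_invariant_def Finv)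
  finally show ?thesis by (simp add: s_def F_def A_def w_GL)
qed

text \<open>With T the Gauss operator, (T - s)(T + s) = 0, and irreducibility makes one of the two
  factors vanish; the witness for \<open>c\<close> is accordingly 1 or -1.\<close>

lemma gauss_op_scalar:
  assumes irr: "absolutely_irreducible sc \<pi>"
    and w: "w \<in> GL" "w ** w = mat 1" and L: "\<Lambda> \<in> dual_space sc" "\<Lambda> v0 \<noteq> 0"
    and T: "\<And>v. \<Lambda> (gauss_op \<psi> v) = s * \<Lambda> (\<pi> w v)"
  shows "\<exists>c. \<forall>v. gauss_op \<psi> v = sc (s * c) v"
proof -
  let ?T = "gauss_op \<psi>"
  define D where "D c v = ?T v - sc c v" for c v
  have D_rep: "D c (\<pi> g v) = \<pi> g (D c v)" if "g \<in> GL" for c g v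
    using that by (simp add: D_def gauss_op_rep rep_diff rep_scale)
  have D_add: "D c (x + y) = D c x + D c y" for c x y
    by (simp add: D_def gauss_op_add scale_right_distrib)
  have D_scale: "D c (sc d x) = sc d (D c x)" for c d x
    by (simp add: D_def gauss_op_scale scale_right_diff_distrib scale_left_commute)
  \<comment> \<open>The translates of \<Lambda> by G form a stable family containing \<Lambda>
    itself, which is not zero, so together they separate the points of V.\<close>
  have faithful: "v = 0" if "\<And>g. g \<in> GL \<Longrightarrow> \<Lambda> (\<pi> g v) = 0" for v
  proof -
    let ?F = "{(\<lambda>v. \<Lambda> (\<pi> g v)) | g. g \<in> GL}"
    have "(\<forall>f\<in>?F. \<forall>v. f v = 0) \<or> (\<forall>v. (\<forall>f\<in>?F. f v = 0) \<longrightarrow> v = 0)"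
    proof (rule stable_functionals[OF irr])
      show "?F \<subseteq> dual_space sc"
        by (auto intro!: dualI simp: rep_add rep_scale dual_add dual_scale L)
      show "(\<lambda>v. f (\<pi> h v)) \<in> ?F" if "f \<in> ?F" "h \<in> GL" for f h
      proof -
        from that(1) obtain g where g: "g \<in> GL" "f = (\<lambda>v. \<Lambda> (\<pi> g v))" by blast
        then have "(\<lambda>v. f (\<pi> h v)) = (\<lambda>v. \<Lambda> (\<pi> (g ** h) v))" using that(2) by (simp add: rep_mult)
        then show ?thesis using g that(2) GL_mult by blast
      qed
    qed
    moreover have "(\<lambda>v. \<Lambda> (\<pi> (mat 1) v)) \<in> ?F" using mat_1_GL by blast
    ultimately show ?thesis using L(2) that by (auto simp: rep_1)
  qed
  have comp: "D s (D (- s) v) = 0" for v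
  proof (rule faithful)
    \<comment> \<open>The hypothesis \<open>T\<close> is used twice: \<open>\<pi> w\<close> is moved
      through the operator in between, and the two factors \<open>\<pi> w\<close> cancel.\<close>
    have TT: "\<Lambda> (?T (?T v)) = s * s * \<Lambda> v" for v
      by (simp add: T gauss_op_rep[OF w(1), symmetric] rep_mult w rep_1)
    have "D s (D (- s) v) = ?T (?T v) - sc (s * s) v" for v
      by (simp add: D_def gauss_op_add gauss_op_scale scale_right_distrib)
    then have "\<Lambda> (D s (D (- s) v)) = 0" for v
      by (simp add: dual_diff dual_scale L TT)
    then show "\<Lambda> (\<pi> g (D s (D (- s) v))) = 0" if "g \<in> GL" for g
      using that by (simp add: D_rep[symmetric])
  qed
  \<comment> \<open>This family is stable because \<open>D s\<close> commutes with G. If it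
    vanishes, then \<open>D s\<close> is 0 by \<open>faithful\<close>; if it separates points, then
    \<open>D (- s)\<close> is 0, since by \<open>comp\<close> the family annihilates its
    image.\<close>
  let ?F = "{(\<lambda>v. \<Lambda> (\<pi> g (D s v))) | g. g \<in> GL}"
  have "(\<forall>f\<in>?F. \<forall>v. f v = 0) \<or> (\<forall>v. (\<forall>f\<in>?F. f v = 0) \<longrightarrow> v = 0)"
  proof (rule stable_functionals[OF irr])
    show "?F \<subseteq> dual_space sc"
      by (auto intro!: dualI simp: rep_add rep_scale dual_add dual_scale L D_add D_scale)
    show "(\<lambda>v. f (\<pi> h v)) \<in> ?F" if "f \<in> ?F" "h \<in> GL" for f h
    proof -
      from that(1) obtain g where g: "g \<in> GL" "f = (\<lambda>v. \<Lambda> (\<pi> g (D s v)))" by blast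
      then have "(\<lambda>v. f (\<pi> h v)) = (\<lambda>v. \<Lambda> (\<pi> (g ** h) (D s v)))"
        using that(2) by (simp add: rep_mult D_rep)
      then show ?thesis using g that(2) GL_mult by blast
    qed
  qed
  then show ?thesis
  proof
    assume 1: "\<forall>f\<in>?F. \<forall>v. f v = 0"
    have "D s v = 0" for v
    proof (rule faithful)
      fix g :: "'k^'n^'n" assume "g \<in> GL"
      then have "(\<lambda>v. \<Lambda> (\<pi> g (D s v))) \<in> ?F" by blast
      from bspec[OF 1 this] show "\<Lambda> (\<pi> g (D s v)) = 0" ..
    qed
    then have "\<forall>v. ?T v = sc (s * 1) v" by (simp add: D_def)
    then show ?thesis ..
  next
    assume 2: "\<forall>v. (\<forall>f\<in>?F. f v = 0) \<longrightarrow> v = 0"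
    have "D (- s) v = 0" for v
    proof -
      have "\<forall>f\<in>?F. f (D (- s) v) = 0" using dual_0[OF L(1)] rep_scale[of _ 0 0] by (auto simp: comp)
      with spec[OF 2, of "D (- s) v"] show ?thesis by (rule mp)
    qed
    then have "\<forall>v. ?T v = sc (s * (- 1)) v" by (simp add: D_def eq_neg_iff_add_eq_0)
    then show ?thesis ..
  qed
qed

text \<open>The Gauss operator is a scalar s c. Paired with all functionals and divided by s, it
  gives \<open>c\<close> as the gamma factor; paired with an \<open>H\<close>-invariant one it is
  also s times \<Lambda> after \<open>\<pi> w\<close>, so \<open>w\<close> acts by
  \<open>c\<close>.\<close>

theorem gamma_factor_eq_chi:
  assumes irr: "absolutely_irreducible sc \<pi>" and cusp: "cuspidal sc \<pi>" and n: "CARD('n) \<ge> 2"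
    and pair: "anticommuting_pair J w \<beta>" and \<psi>: "nontrivial_additive_character \<psi>"
    and dist: "distinguished sc \<pi> (centralizer J \<inter> GL)"
    and nz: "of_nat (card (centralizer J)) \<noteq> (0 :: 'r)"
  shows "gamma_factor sc \<pi> \<psi> (of_nat (card (centralizer J))) = chi sc \<pi> (centralizer J \<inter> GL) w"
proof -
  interpret anticommuting_pair J w \<beta> by (rule pair)
  define H where "H = centralizer J \<inter> GL"
  define s where "s = (of_nat (card (centralizer J)) :: 'r)"
  obtain \<Lambda>\<^sub>0 where L0: "\<Lambda>\<^sub>0 \<in> Hom_triv sc \<pi> H" "\<Lambda>\<^sub>0 \<noteq> (\<lambda>_. 0)"
    using dist by (auto simp: distinguished_def H_def)
  \<comment> \<open>Uniqueness in both definite descriptions is tested on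
    \<open>\<Lambda>\<^sub>0\<close> at this vector.\<close>
  then obtain v0 where v0: "\<Lambda>\<^sub>0 v0 \<noteq> 0" by auto
  have L0': "\<Lambda>\<^sub>0 \<in> dual_space sc" using L0 by (simp add: Hom_triv_def)
  have T: "\<Lambda> (gauss_op \<psi> v) = s * \<Lambda> (\<pi> w v)" if "\<Lambda> \<in> Hom_triv sc \<pi> H" for \<Lambda> v
    using gauss_op_Hom_triv[OF cusp n pair \<psi>] that by (simp add: H_def s_def)
  obtain c where c: "\<And>v. gauss_op \<psi> v = sc (s * c) v"
    using gauss_op_scalar[OF irr w_GL(1) w_square L0' v0 T[OF L0(1)]] by blast
  have s: "s \<noteq> 0" using nz by (simp add: s_def)
  have "gamma_factor sc \<pi> \<psi> s = c"
    unfolding gamma_factor_def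
  proof (rule the_equality)
    have *: "inverse s * (\<Sum>g\<in>GL. \<psi> (trace g) * contragredient \<pi> g \<Lambda> v) = c * \<Lambda> v"
      if "\<Lambda> \<in> dual_space sc" for \<Lambda> v
      unfolding contragredient_def dual_gauss_op[OF that, symmetric]
      using s by (simp add: c dual_scale that)
    then show "\<forall>\<Lambda>\<in>dual_space sc. \<forall>v. inverse s *
        (\<Sum>g\<in>GL. \<psi> (trace g) * contragredient \<pi> g \<Lambda> v) = c * \<Lambda> v" by blast
    show "d = c" if "\<forall>\<Lambda>\<in>dual_space sc. \<forall>v. inverse s *
        (\<Sum>g\<in>GL. \<psi> (trace g) * contragredient \<pi> g \<Lambda> v) = d * \<Lambda> v" for d
      using that *[OF L0', of v0] L0' v0 by (metis mult_right_cancel)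
  qed
  moreover have "chi sc \<pi> H w = c"
  proof -
    have *: "\<Lambda> (\<pi> w v) = c * \<Lambda> v" if "\<Lambda> \<in> Hom_triv sc \<pi> H" for \<Lambda> v
    proof -
      have "\<Lambda> \<in> dual_space sc" using that by (simp add: Hom_triv_def)
      then have "s * \<Lambda> (\<pi> w v) = s * c * \<Lambda> v"
        unfolding T[OF that, symmetric] c by (rule dual_scale)
      then show ?thesis using s by (simp add: mult.assoc)
    qed
    have "(THE c. \<forall>\<Lambda>\<in>Hom_triv sc \<pi> H. \<forall>v. \<Lambda> (\<pi> w v) = c * \<Lambda> v) = c"
    proof (rule the_equality)
      show "\<forall>\<Lambda>\<in>Hom_triv sc \<pi> H. \<forall>v. \<Lambda> (\<pi> w v) = c * \<Lambda> v" using * by blast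
      show "d = c" if "\<forall>\<Lambda>\<in>Hom_triv sc \<pi> H. \<forall>v. \<Lambda> (\<pi> w v) = d * \<Lambda> v" for d
        using that *[OF L0(1), of v0] L0 v0 by (metis mult_right_cancel)
    qed
    then show ?thesis using w_normalizer by (simp add: chi_def H_def)
  qed
  ultimately show ?thesis by (simp add: s_def H_def)
qed

end

section \<open>Block matrices\<close>

lemma block_mat_cases:
  fixes g :: "'k^('m::finite + 'm)^('m + 'm)"
  obtains x y z t where "g = block_mat x y z t"
proof -
  have "g = block_mat (\<chi> a b. g $ Inl a $ Inl b) (\<chi> a b. g $ Inl a $ Inr b)
      (\<chi> a b. g $ Inr a $ Inl b) (\<chi> a b. g $ Inr a $ Inr b)"
    by (auto simp: block_mat_def vec_eq_iff split: sum.splits)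
  then show ?thesis using that by blast
qed

lemma block_mat_eq_iff:
  "block_mat x y z t = block_mat x' y' z' t' \<longleftrightarrow> x = x' \<and> y = y' \<and> z = z' \<and> t = t'"
proof
  assume e: "block_mat x y z t = block_mat x' y' z' t'"
  have "block_mat x y z t $ i $ j = block_mat x' y' z' t' $ i $ j" for i j by (simp add: e)
  from this[of "Inl _" "Inl _"] this[of "Inl _" "Inr _"] this[of "Inr _" "Inl _"] this[of "Inr _" "Inr _"]
  show "x = x' \<and> y = y' \<and> z = z' \<and> t = t'"
    by (simp add: block_mat_def vec_eq_iff)
qed simp

lemma block_mat_mult:
  fixes x :: "'k::field^'m::finite^'m"
  shows "block_mat x y z t ** block_mat x' y' z' t' =
    block_mat (x ** x' + y ** z') (x ** y' + y ** t') (z ** x' + t ** z') (z ** y' + t ** t')"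
proof -
  have "(\<Sum>k\<in>UNIV. f k) = (\<Sum>a\<in>UNIV. f (Inl a)) + (\<Sum>a\<in>UNIV. f (Inr a))" for f :: "'m + 'm \<Rightarrow> 'k"
    by (simp add: sum.Plus flip: UNIV_Plus_UNIV)
  then show ?thesis
    by (auto simp: block_mat_def vec_eq_iff matrix_matrix_mult_def split: sum.splits)
qed

lemma mat_eq_block_mat: "mat c = block_mat (mat c) 0 0 (mat c)"
  by (auto simp: block_mat_def vec_eq_iff mat_def split: sum.splits)

lemma uminus_block_mat: "- block_mat x y z t = block_mat (- x) (- y) (- z) (- t)"
  by (auto simp: block_mat_def vec_eq_iff split: sum.splits)

lemma matrix_zero_mult: "0 ** x = (0 :: 'k::field^'n^'n)" "x ** 0 = (0 :: 'k::field^'n^'n)"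
  by (simp_all add: vec_eq_iff matrix_matrix_mult_def)

text \<open>Commuting with diag(1, -1) makes the off-diagonal blocks equal to their negatives, hence
  0. The inverse also commutes, so it is block diagonal too and its blocks invert those of
  \<open>g\<close>.\<close>

lemma GL_prod_eq_centralizer:
  assumes "(2 :: 'k::field) \<noteq> 0"
  shows "(GL_prod :: ('k^('m::finite + 'm)^('m + 'm)) set) =
    centralizer (block_mat (mat 1) 0 0 (- mat 1)) \<inter> GL" (is "_ = centralizer ?J \<inter> _")
proof
  show "GL_prod \<subseteq> centralizer ?J \<inter> GL"
  proof
    fix g :: "'k^('m + 'm)^('m + 'm)" assume "g \<in> GL_prod"
    then obtain x y where g: "g = block_mat x 0 0 y" "x \<in> GL" "y \<in> GL" by (auto simp: GL_prod_def)
    have "g ** block_mat (matrix_inv x) 0 0 (matrix_inv y) = mat 1"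
      using g by (simp add: block_mat_mult matrix_zero_mult GL_matrix_inv mat_eq_block_mat)
    then have "g \<in> GL" by (rule matrix_inv_unique_GL)
    then show "g \<in> centralizer ?J \<inter> GL"
      by (simp add: g centralizer_def block_mat_mult block_mat_eq_iff matrix_zero_mult matrix_mult_minus_left matrix_mult_minus_right)
  qed
  have diag: "\<exists>x t. g = block_mat x 0 0 t" if gc: "g \<in> centralizer ?J" for g :: "'k^('m + 'm)^('m + 'm)"
  proof -
    obtain x y z t where g: "g = block_mat x y z t" by (rule block_mat_cases)
    have "y = - y" "z = - z" using gc unfolding g
      by (auto simp: centralizer_def block_mat_mult block_mat_eq_iff matrix_zero_mult matrix_mult_minus_left matrix_mult_minus_right)
    then have "y = 0" "z = 0" using matrix_eq_minus_self[OF assms] by blast+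
    then show ?thesis using g by blast
  qed
  show "centralizer ?J \<inter> GL \<subseteq> GL_prod"
  proof
    fix g :: "'k^('m + 'm)^('m + 'm)" assume g: "g \<in> centralizer ?J \<inter> GL"
    then obtain x t where xt: "g = block_mat x 0 0 t" using diag by blast
    have "matrix_inv g \<in> centralizer ?J" using g by (simp add: centralizer_matrix_inv)
    then obtain x' t' where xt': "matrix_inv g = block_mat x' 0 0 t'" using diag by blast
    have "g ** matrix_inv g = mat 1" using g by (simp add: GL_matrix_inv)
    then have "x ** x' = mat 1" "t ** t' = mat 1"
      unfolding xt' unfolding xt by (simp_all add: block_mat_mult matrix_zero_mult mat_eq_block_mat block_mat_eq_iff)
    then have "x \<in> GL" "t \<in> GL" by (auto intro: matrix_inv_unique_GL(1))
    then show "g \<in> GL_prod" using xt by (auto simp: GL_prod_def)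
  qed
qed

text \<open>The matrix on the right is the image of the square root of \<alpha>; comparing blocks in
  the commutation relation gives the shape of the embedded matrices.\<close>

lemma mat_quadratic_eq_centralizer:
  "mat_quadratic \<alpha> = centralizer (block_mat 0 (mat 1) (mat \<alpha>) 0)"
proof -
  have \<alpha>: "(\<chi> i j. \<alpha> * y $ i $ j) = mat \<alpha> ** y" for y :: "'a^'b^'b"
    by (simp add: vec_eq_iff matrix_matrix_mult_def mat_def if_distrib[of "\<lambda>x. x * _"] cong: if_cong)
  have c: "block_mat x y z t \<in> centralizer (block_mat 0 (mat 1) (mat \<alpha>) 0) \<longleftrightarrow> z = mat \<alpha> ** y \<and> t = x"
    for x y z t :: "'a^'b^'b"
    by (auto simp: centralizer_def block_mat_mult block_mat_eq_iff matrix_zero_mult mat_commute[of \<alpha>])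
  show ?thesis
  proof (rule Set.set_eqI)
    fix g :: "'a^('b + 'b)^('b + 'b)"
    obtain x y z t where g: "g = block_mat x y z t" by (rule block_mat_cases)
    show "g \<in> mat_quadratic \<alpha> \<longleftrightarrow> g \<in> centralizer (block_mat 0 (mat 1) (mat \<alpha>) 0)"
      unfolding g c by (auto simp: mat_quadratic_def \<alpha> block_mat_eq_iff)
  qed
qed

lemma unit_group_centralizer: "unit_group (centralizer J) = centralizer J \<inter> GL"
proof
  show "unit_group (centralizer J) \<subseteq> centralizer J \<inter> GL"
    by (auto simp: unit_group_def GL_def invertible_def)
  show "centralizer J \<inter> GL \<subseteq> unit_group (centralizer J)"
    unfolding unit_group_def using centralizer_matrix_inv GL_matrix_inv by blast
qed

section \<open>Arithmetic of the finite field k\<close>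

lemma of_nat_CARD_neq_0:
  assumes "CHAR('r::field) \<noteq> CHAR('k::{field,finite})"
  shows "of_nat CARD('k) \<noteq> (0 :: 'r)"
proof
  assume "of_nat CARD('k) = (0 :: 'r)"
  then have dvd: "CHAR('r) dvd CARD('k)" by (simp add: of_nat_eq_0_iff_char_dvd)
  then have "CHAR('r) > 0" by (metis dvd_pos_nat zero_less_card_finite)
  then have l: "Factorial_Ring.prime (CHAR('r))" by (rule prime_CHAR_semidom)
  \<comment> \<open>Cauchy's theorem, as the case of exponent 1 of Sylow's, is applied to the
    additive group of k for the prime CHAR('r). It gives a nonzero \<open>x\<close> killed by that
    prime, which must then be the characteristic of k.\<close>
  define G where "G = \<lparr>carrier = UNIV :: 'k set, mult = (+), one = (0 :: 'k)\<rparr>"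
  have pow: "x [^]\<^bsub>G\<^esub> (n::nat) = of_nat n * x" for x n
    by (induction n) (simp_all add: G_def nat_pow_def algebra_simps)
  interpret group G
    by (rule groupI) (auto simp: G_def add.assoc intro: exI[of _ "- _"] left_minus)
  obtain m where "CARD('k) = CHAR('r) * m" using dvd by (auto simp: dvd_def)
  then obtain H where H: "subgroup H G" "card H = CHAR('r)"
    using sylow_thm[OF l is_group, of 1 m] by (auto simp: order_def G_def)
  have "card H \<ge> 2" using H l by (simp add: prime_ge_2_nat)
  then obtain x where x: "x \<in> H" "x \<noteq> 0"
    by (metis card_le_Suc0_iff_eq card.infinite not_less_eq_eq numeral_2_eq_2 zero_le)
  interpret S: group "G\<lparr>carrier := H\<rparr>" using H(1) by (rule subgroup_imp_group)
  have "x [^]\<^bsub>G\<lparr>carrier := H\<rparr>\<^esub> order (G\<lparr>carrier := H\<rparr>) = \<one>\<^bsub>G\<lparr>carrier := H\<rparr>\<^esub>"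
    using x by (intro S.pow_order_eq_1) simp
  then have "of_nat (CHAR('r)) * x = 0"
    using H pow[of x "CHAR('r)"] by (simp add: order_def nat_pow_consistent[symmetric]) (simp add: G_def)
  then have "CHAR('k) dvd CHAR('r)" using x by (simp add: of_nat_eq_0_iff_char_dvd)
  then show False using assms l by (metis CHAR_not_1' One_nat_def prime_nat_iff)
qed

text \<open>The Frobenius map is injective, hence surjective on a finite field. A nonsquare \<alpha>
  therefore forces 2 to be invertible.\<close>

lemma square_exists_char_2:
  fixes \<alpha> :: "'k::{field,finite}"
  assumes "(2::'k) = 0"
  shows "\<exists>\<beta>. \<beta>\<^sup>2 = \<alpha>"
proof -
  have "inj (\<lambda>x::'k. x\<^sup>2)"
  proof (rule injI)
    fix x y :: 'k assume "x\<^sup>2 = y\<^sup>2"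
    then have "(x - y)\<^sup>2 = 2 * (y\<^sup>2 - x * y)" by (simp add: power2_eq_square algebra_simps)
    then show "x = y" using assms by simp
  qed
  then have "surj (\<lambda>x::'k. x\<^sup>2)" by (simp add: finite_UNIV_inj_surj)
  then show ?thesis by (metis surjD)
qed

section \<open>The split and the quadratic case\<close>

theorem theorem5p3:
  fixes p :: nat
    and sc :: "'r::field \<Rightarrow> 'v::ab_group_add \<Rightarrow> 'v"
    and \<pi> :: "'k::{field,finite}^('m::finite + 'm)^('m + 'm) \<Rightarrow> 'v \<Rightarrow> 'v"
    and \<psi> :: "'k \<Rightarrow> 'r"
    and H :: "('k^('m + 'm)^('m + 'm)) set"
    and w :: "'k^('m + 'm)^('m + 'm)"
  assumes "CHAR('k) = p"
    and "CHAR('r) \<noteq> p"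
    and "card {\<zeta>::'r. \<zeta> ^ p = 1} = p"
    and "is_rep sc \<pi>"
    and "absolutely_irreducible sc \<pi>"
    and "cuspidal sc \<pi>"
    and "distinguished sc \<pi> H"
    and "(odd p \<and> H = GL_prod \<and> w = block_mat 0 (mat 1) (mat 1) 0) \<or>
         (\<exists>\<alpha>. \<alpha> \<noteq> 0 \<and> (\<nexists>\<beta>. \<beta>\<^sup>2 = \<alpha>) \<and> H = GL_quadratic \<alpha> \<and>
              w = block_mat (mat 1) 0 0 (- mat 1))"
    and "nontrivial_additive_character \<psi>"
  shows "gamma_factor sc \<pi> \<psi> (of_nat CARD('k) ^ (2 * CARD('m)\<^sup>2)) = chi sc \<pi> H w"
proof -
  interpret gl_rep sc \<pi> by unfold_locales fact
  have "\<exists>J \<beta>. anticommuting_pair J w \<beta> \<and> H = centralizer J \<inter> GL"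
    using assms(8)
  proof (elim disjE exE conjE)
    assume p: "odd p" and H: "H = GL_prod" and w: "w = block_mat 0 (mat 1) (mat 1) 0"
    have two: "(2::'k) \<noteq> 0"
    proof
      assume "(2::'k) = 0"
      then have "p dvd 2" using of_nat_eq_0_iff_char_dvd[of 2, where 'a = 'k] assms(1) by simp
      then have "p \<le> 2" by (simp add: dvd_imp_le)
      with p have "p = 1" by presburger
      then show False using assms(1) CHAR_not_1'[where 'a = 'k] by simp
    qed
    have "anticommuting_pair (block_mat (mat 1) 0 0 (- mat 1)) w (1::'k)"
      by unfold_locales (use two in \<open>simp_all add: w mat_eq_block_mat block_mat_mult
        matrix_zero_mult uminus_block_mat matrix_mult_minus_left matrix_mult_minus_right\<close>)
    then show ?thesis using GL_prod_eq_centralizer[OF two] H by blast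
  next
    fix \<alpha> :: 'k
    assume \<alpha>: "\<alpha> \<noteq> 0" "\<nexists>\<beta>. \<beta>\<^sup>2 = \<alpha>" and H: "H = GL_quadratic \<alpha>"
      and w: "w = block_mat (mat 1) 0 0 (- mat 1)"
    have two: "(2::'k) \<noteq> 0" using square_exists_char_2 \<alpha>(2) by blast
    have "anticommuting_pair (block_mat 0 (mat 1) (mat \<alpha>) 0) w \<alpha>"
      by unfold_locales (use two \<alpha> in \<open>simp_all add: w mat_eq_block_mat block_mat_mult
        matrix_zero_mult uminus_block_mat matrix_mult_minus_left matrix_mult_minus_right\<close>)
    moreover have "H = centralizer (block_mat 0 (mat 1) (mat \<alpha>) 0) \<inter> GL"
      by (simp add: H GL_quadratic_def mat_quadratic_eq_centralizer unit_group_centralizer)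
    ultimately show ?thesis by blast
  qed
  then obtain J \<beta> where J: "anticommuting_pair J w \<beta>" and H: "H = centralizer J \<inter> GL" by blast
  let ?q = "CARD('k)" and ?m = "CARD('m)"
  \<comment> \<open>The exponent 4 m^2 of the number of matrices is written as twice 2 m^2, so that
    |A| is identified with the prescribed square root.\<close>
  have "CARD('m + 'm) * CARD('m + 'm) = 2 * ?m\<^sup>2 * 2"
    by (simp add: power2_eq_square algebra_simps)
  then have "(card (centralizer J))\<^sup>2 = (?q ^ (2 * ?m\<^sup>2))\<^sup>2"
    using anticommuting_pair.card_centralizer[OF J] by (simp only: power_mult)
  then have card: "card (centralizer J) = ?q ^ (2 * ?m\<^sup>2)" by (rule power2_eq_imp_eq) auto
  have "CARD('m + 'm) \<ge> 2" using zero_less_card_finite[where 'a = 'm] unfolding card_sum by linarith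
  moreover have "of_nat (card (centralizer J)) \<noteq> (0::'r)"
    using of_nat_CARD_neq_0[where 'r = 'r and 'k = 'k] assms(1,2) by (simp add: card)
  ultimately have "gamma_factor sc \<pi> \<psi> (of_nat (card (centralizer J))) = chi sc \<pi> H w"
    using gamma_factor_eq_chi[OF assms(5,6) _ J assms(9)] assms(7) H by blast
  then show ?thesis by (simp add: card)
qed

end
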